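(* Let $p$ be a prime and let $f_1,\dots,f_m\in\mathbb{Q}_p[x]$, $m\geq2$, with $\deg f_1>\deg f_2>\dots>\deg f_m\geq1$. Let $a_0=\max\{\mathrm{Ess}_{f_i}:1\le i\le m\}$ and let $a,T$ be positive integers with $T>a>a_0$. Set $L=2(T-a+1)(1-1/p)$. Then for all $(\lambda_1,\dots,\lambda_m)\in\mathbb{Q}_p^m$, $$-\frac{16\sum_{i=1}^mp^{\deg f_i}}{L}\leq\widehat{\mu_T}(\lambda_1,\dots,\lambda_m):=\frac1L\int_{p^a\leq\|s\|_p\leq p^T}\frac{\psi\big(\sum_i\lambda_if_i(s)\big)+\overline{\psi}\big(\sum_i\lambda_if_i(s)\big)}{\|s\|_p}\,ds.$$
   Context: $\|\cdot\|_p$ is the $p$-adic absolute value, and $ds$ is Haar measure on $\mathbb{Q}_p$ normalized so that $\mathbb{Z}_p$ has measure $1$. $\psi:\mathbb{Q}_p\to\mathbb{C}^*$ is the character $\psi(x)=\exp(2\pi i r_x/p^{n_x})$, where $n_x$ is the least non-negative integer with $p^{n_x}x\in\mathbb{Z}_p$ and $r_x\equiv p^{n_x}x\pmod{p^{n_x}}$ is an integer. For $f(x)=a_nx^n+\dots+a_0$ with $a_n\neq0$, $n\ge1$, $\mathrm{Ess}_f=\max\big(\{0\}\cup\{\log_p(\|a_i\|_p/\|a_n\|_p):a_i\neq0,\ 0\le i\le n-1\}\big)$. The quantity $\widehat{\mu_T}$ is the Fourier transform of the symmetric probability measure $\mu_T(E)=\frac1L\int_{p^a\le\|s\|_p\le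 p^T}\frac{\mathbf{1}_E(F(s))+\mathbf{1}_{-E}(F(s))}{\|s\|_p}ds$, $F=(f_1,\dots,f_m)$. *)

theory Defs
  imports
    "HOL-Analysis.Analysis"
    "HOL-Computational_Algebra.Computational_Algebra"
    "Berlekamp_Zassenhaus.Finite_Field"
begin

section \<open>The $p$-adic absolute value on the rationals\<close>

definition rat_val :: "nat \<Rightarrow> rat \<Rightarrow> int" where
  "rat_val p x = int (multiplicity (int p) (fst (quotient_of x)))
               - int (multiplicity (int p) (snd (quotient_of x)))"

definition rat_pabs :: "nat \<Rightarrow> rat \<Rightarrow> real" where
  "rat_pabs p x = (if x = 0 then 0 else real p powi (- rat_val p x))"

definition pcauchy :: "nat \<Rightarrow> (nat \<Rightarrow> rat) \<Rightarrow> bool" where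
  "pcauchy p X \<longleftrightarrow> (\<forall>e>0. \<exists>N. \<forall>m\<ge>N. \<forall>n\<ge>N. rat_pabs p (X m - X n) < e)"

definition pnull :: "nat \<Rightarrow> (nat \<Rightarrow> rat) \<Rightarrow> bool" where
  "pnull p X \<longleftrightarrow> (\<lambda>n. rat_pabs p (X n)) \<longlonglongrightarrow> 0"

definition padic_rel :: "nat \<Rightarrow> (nat \<Rightarrow> rat) \<Rightarrow> (nat \<Rightarrow> rat) \<Rightarrow> bool" where
  "padic_rel p X Y \<longleftrightarrow> pcauchy p X \<and> pcauchy p Y \<and> pnull p (\<lambda>n. X n - Y n)"

context
  fixes p :: nat
  assumes p: "prime p"
begin

lemma p_gt_1: "real p > 1"
  using prime_gt_1_nat[OF p] by simp

lemma rat_val_frac: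
  assumes "a \<noteq> 0" "b \<noteq> 0"
  shows "rat_val p (of_int a / of_int b)
       = int (multiplicity (int p) a) - int (multiplicity (int p) b)"
proof -
  define x where "x = (of_int a / of_int b :: rat)"
  obtain c d where cd: "quotient_of x = (c, d)" by (cases "quotient_of x")
  have d: "d > 0" using quotient_of_denom_pos[OF cd] .
  have x: "x = of_int c / of_int d" using quotient_of_div[OF cd] .
  have "x \<noteq> 0" using assms by (simp add: x_def)
  hence c: "c \<noteq> 0" using x by auto
  have "of_int (a * d) = (of_int (c * b) :: rat)"
    using x d assms unfolding x_def by (simp add: field_simps)
  hence eq: "a * d = c * b" by (simp only: of_int_eq_iff)
  have pe: "prime_elem (int p)" using p by simp
  have "multiplicity (int p) a + multiplicity (int p) d = multiplicity (int p) c + multiplicity (int p) b"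
    using arg_cong[OF eq, of "multiplicity (int p)"] pe assms c d
    by (simp add: prime_elem_multiplicity_mult_distrib)
  thus ?thesis unfolding x_def[symmetric] rat_val_def cd by simp
qed

lemma rat_frac_cases:
  fixes x :: rat
  obtains a b where "b \<noteq> 0" "x = of_int a / of_int b"
  by (metis quotient_of_div quotient_of_denom_pos surj_pair less_irrefl)

lemma rat_pabs_0 [simp]: "rat_pabs p 0 = 0"
  by (simp add: rat_pabs_def)

lemma rat_pabs_pos: "x \<noteq> 0 \<Longrightarrow> rat_pabs p x > 0"
  using p_gt_1 by (simp add: rat_pabs_def zero_less_power_int)

lemma rat_pabs_nonneg [simp]: "rat_pabs p x \<ge> 0"
  using rat_pabs_pos[of x] by (cases "x = 0") auto

lemma rat_pabs_eq_0 [simp]: "rat_pabs p x = 0 \<longleftrightarrow> x = 0"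
  using rat_pabs_pos[of x] by force

lemma rat_pabs_mult: "rat_pabs p (x * y) = rat_pabs p x * rat_pabs p y"
proof (cases "x = 0 \<or> y = 0")
  case False
  obtain a b where x: "b \<noteq> 0" "x = of_int a / of_int b" by (rule rat_frac_cases)
  obtain c d where y: "d \<noteq> 0" "y = of_int c / of_int d" by (rule rat_frac_cases)
  have ac: "a \<noteq> 0" "c \<noteq> 0" using x y False by auto
  have xy: "x * y = of_int (a * c) / of_int (b * d)" using x y by simp
  have pe: "prime_elem (int p)" using p by simp
  have "rat_val p (x * y) = rat_val p x + rat_val p y"
    unfolding xy using ac x y pe
    by (simp only: rat_val_frac mult_eq_0_iff x(2) y(2) simp_thms
        prime_elem_multiplicity_mult_distrib of_nat_add)
  hence "- rat_val p (x * y) = - rat_val p x + - rat_val p y" by simp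
  thus ?thesis using False p_gt_1
    by (simp only: rat_pabs_def mult_eq_0_iff if_False) (subst power_int_add, auto)
qed (auto simp: rat_pabs_def)

lemma rat_pabs_1 [simp]: "rat_pabs p 1 = 1"
  using rat_pabs_mult[of 1 1] by simp

lemma rat_pabs_minus [simp]: "rat_pabs p (- x) = rat_pabs p x"
proof -
  have "rat_pabs p (-1) * rat_pabs p (-1) = 1"
    using rat_pabs_mult[of "-1" "-1"] by simp
  hence "rat_pabs p (-1) = 1"
    by (metis rat_pabs_nonneg abs_of_nonneg abs_1 power2_eq_square power2_eq_iff
        one_power2 minus_equation_iff zero_le_one abs_minus_cancel)
  thus ?thesis using rat_pabs_mult[of "-1" x] by simp
qed

lemma rat_pabs_minus_commute: "rat_pabs p (x - y) = rat_pabs p (y - x)"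
  using rat_pabs_minus[of "x - y"] by simp

lemma rat_pabs_inverse: "rat_pabs p (inverse x) = inverse (rat_pabs p x)"
proof (cases "x = 0")
  case False
  hence "rat_pabs p (inverse x) * rat_pabs p x = 1"
    using rat_pabs_mult[of "inverse x" x] by simp
  thus ?thesis by (metis inverse_unique mult.commute)
qed auto

lemma rat_pabs_add: "rat_pabs p (x + y) \<le> max (rat_pabs p x) (rat_pabs p y)"
proof (cases "x = 0 \<or> y = 0 \<or> x + y = 0")
  case False
  obtain a b where x: "b \<noteq> 0" "x = of_int a / of_int b" by (rule rat_frac_cases)
  obtain c d where y: "d \<noteq> 0" "y = of_int c / of_int d" by (rule rat_frac_cases)
  define a' c' e where "a' = a * d" "c' = c * b" "e = b * d"
  have e: "e \<noteq> 0" using x y by (simp add: a'_c'_e_def)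
  have x': "x = of_int a' / of_int e" and y': "y = of_int c' / of_int e"
    using x y by (simp_all add: a'_c'_e_def)
  have xy: "x + y = of_int (a' + c') / of_int e"
    unfolding x' y' by (simp add: add_divide_distrib)
  have nz: "a' \<noteq> 0" "c' \<noteq> 0" "a' + c' \<noteq> 0" using False x' y' xy by auto
  define k where "k = min (multiplicity (int p) a') (multiplicity (int p) c')"
  have "int p ^ k dvd a'" "int p ^ k dvd c'"
    by (auto simp: k_def intro: multiplicity_dvd')
  hence "int p ^ k dvd a' + c'" by (rule dvd_add)
  hence "k \<le> multiplicity (int p) (a' + c')"
    using nz p by (intro multiplicity_geI) (auto simp: prime_gt_1_nat)
  hence "min (rat_val p x) (rat_val p y) \<le> rat_val p (x + y)"
    using rat_val_frac[OF nz(1) e] rat_val_frac[OF nz(2) e] rat_val_frac[OF nz(3) e]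
    unfolding x'[symmetric] y'[symmetric] xy[symmetric] k_def by linarith
  hence "- rat_val p (x + y) \<le> - rat_val p x \<or> - rat_val p (x + y) \<le> - rat_val p y"
    by linarith
  thus ?thesis using False p_gt_1 unfolding rat_pabs_def
    by (auto simp: le_max_iff_disj intro: power_int_increasing)
qed (auto simp: le_max_iff_disj add_eq_0_iff)

lemma rat_pabs_diff: "rat_pabs p (x - y) \<le> max (rat_pabs p x) (rat_pabs p y)"
  using rat_pabs_add[of x "- y"] by simp

lemma rat_pabs_triangle: "\<bar>rat_pabs p x - rat_pabs p y\<bar> \<le> rat_pabs p (x - y)"
proof -
  have "rat_pabs p x \<le> max (rat_pabs p (x - y)) (rat_pabs p y)"
    using rat_pabs_add[of "x - y" y] by simp
  moreover have "rat_pabs p y \<le> max (rat_pabs p (x - y)) (rat_pabs p x)"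
    using rat_pabs_add[of "y - x" x] rat_pabs_minus_commute[of x y] by simp
  ultimately show ?thesis using rat_pabs_nonneg[of x] rat_pabs_nonneg[of y]
      rat_pabs_nonneg[of "x - y"] by linarith
qed

lemma pcauchyD: "pcauchy p X \<Longrightarrow> e > 0 \<Longrightarrow> \<exists>N. \<forall>m\<ge>N. \<forall>n\<ge>N. rat_pabs p (X m - X n) < e"
  by (simp add: pcauchy_def)

lemma pcauchy_const: "pcauchy p (\<lambda>_. c)"
  by (simp add: pcauchy_def)

lemma pcauchy_minus: "pcauchy p X \<Longrightarrow> pcauchy p (\<lambda>n. - X n)"
proof -
  have "- a - - b = - (a - b)" for a b :: rat by simp
  thus "pcauchy p X \<Longrightarrow> ?thesis"
    unfolding pcauchy_def by (simp only: rat_pabs_minus)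
qed

lemma pcauchy_add:
  assumes "pcauchy p X" "pcauchy p Y"
  shows "pcauchy p (\<lambda>n. X n + Y n)"
  unfolding pcauchy_def
proof safe
  fix e :: real assume e: "e > 0"
  obtain N M where N: "\<forall>m\<ge>N. \<forall>n\<ge>N. rat_pabs p (X m - X n) < e"
    and M: "\<forall>m\<ge>M. \<forall>n\<ge>M. rat_pabs p (Y m - Y n) < e"
    using assms pcauchyD e by meson
  have "rat_pabs p (X m + Y m - (X n + Y n)) < e" if "m \<ge> max N M" "n \<ge> max N M" for m n
    using rat_pabs_add[of "X m - X n" "Y m - Y n"] N M that
    by (auto simp: algebra_simps intro: le_less_trans)
  thus "\<exists>N. \<forall>m\<ge>N. \<forall>n\<ge>N. rat_pabs p (X m + Y m - (X n + Y n)) < e" by blast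
qed

lemma pcauchy_convergent:
  assumes "pcauchy p X"
  shows "convergent (\<lambda>n. rat_pabs p (X n))"
proof -
  have "Cauchy (\<lambda>n. rat_pabs p (X n))"
    unfolding Cauchy_def dist_real_def
    using pcauchyD[OF assms] rat_pabs_triangle by (meson le_less_trans)
  thus ?thesis by (rule Cauchy_convergent)
qed

lemma pcauchy_bounded:
  assumes "pcauchy p X"
  obtains B where "B > 0" "\<And>n. rat_pabs p (X n) \<le> B"
proof -
  have "Bseq (\<lambda>n. rat_pabs p (X n))"
    using pcauchy_convergent[OF assms] by (rule convergent_imp_Bseq)
  then obtain K where "K > 0" "\<And>n. norm (rat_pabs p (X n)) \<le> K"
    unfolding Bseq_def by blast
  thus ?thesis using that[of K] by simp
qed

lemma pcauchy_mult:
  assumes "pcauchy p X" "pcauchy p Y"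
  shows "pcauchy p (\<lambda>n. X n * Y n)"
  unfolding pcauchy_def
proof safe
  fix e :: real assume e: "e > 0"
  obtain A where A: "A > 0" "\<And>n. rat_pabs p (X n) \<le> A" by (rule pcauchy_bounded[OF assms(1)]) blast
  obtain B where B: "B > 0" "\<And>n. rat_pabs p (Y n) \<le> B" by (rule pcauchy_bounded[OF assms(2)]) blast
  have "e / B > 0" "e / A > 0" using e A B by auto
  then obtain N M where N: "\<forall>m\<ge>N. \<forall>n\<ge>N. rat_pabs p (X m - X n) < e / B"
    and M: "\<forall>m\<ge>M. \<forall>n\<ge>M. rat_pabs p (Y m - Y n) < e / A"
    using assms pcauchyD by meson
  have "rat_pabs p (X m * Y m - X n * Y n) < e" if mn: "m \<ge> max N M" "n \<ge> max N M" for m n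
  proof -
    have "rat_pabs p (X m) * rat_pabs p (Y m - Y n) \<le> A * rat_pabs p (Y m - Y n)"
      using A by (intro mult_right_mono) auto
    also have "\<dots> < A * (e / A)" using M mn A by (intro mult_strict_left_mono) auto
    finally have 1: "rat_pabs p (X m * (Y m - Y n)) < e" using A by (simp add: rat_pabs_mult)
    have "rat_pabs p (X m - X n) * rat_pabs p (Y n) \<le> rat_pabs p (X m - X n) * B"
      using B by (intro mult_left_mono) auto
    also have "\<dots> < (e / B) * B" using N mn B by (intro mult_strict_right_mono) auto
    finally have 2: "rat_pabs p ((X m - X n) * Y n) < e" using B by (simp add: rat_pabs_mult)
    have "X m * Y m - X n * Y n = X m * (Y m - Y n) + (X m - X n) * Y n"
      by (simp add: algebra_simps)
    thus ?thesis using 1 2 rat_pabs_add[of "X m * (Y m - Y n)" "(X m - X n) * Y n"] by simp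
  qed
  thus "\<exists>N. \<forall>m\<ge>N. \<forall>n\<ge>N. rat_pabs p (X m * Y m - X n * Y n) < e" by blast
qed

lemma pcauchy_not_null:
  assumes "pcauchy p X" "\<not> pnull p X"
  obtains b N where "b > 0" "\<And>n. n \<ge> N \<Longrightarrow> rat_pabs p (X n) > b"
proof -
  obtain L where L: "(\<lambda>n. rat_pabs p (X n)) \<longlonglongrightarrow> L"
    using pcauchy_convergent[OF assms(1)] by (auto simp: convergent_def)
  have "L \<ge> 0" using L by (rule LIMSEQ_le_const) auto
  moreover have "L \<noteq> 0" using assms(2) L by (auto simp: pnull_def)
  ultimately have "L > 0" by simp
  hence "eventually (\<lambda>n. rat_pabs p (X n) > L / 2) sequentially"
    using L by (intro order_tendstoD(1)[OF L]) auto
  thus ?thesis using that[of "L / 2"] \<open>L > 0\<close> by (auto simp: eventually_sequentially)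
qed

lemma pnull_0: "pnull p (\<lambda>_. 0)"
  by (simp add: pnull_def)

lemma pnull_le:
  assumes "pnull p X" "eventually (\<lambda>n. rat_pabs p (Y n) \<le> C * rat_pabs p (X n)) sequentially"
  shows "pnull p Y"
  unfolding pnull_def
proof (rule tendsto_sandwich[OF _ assms(2) tendsto_const])
  show "(\<lambda>n. C * rat_pabs p (X n)) \<longlonglongrightarrow> 0"
    using assms(1) unfolding pnull_def by (rule tendsto_mult_right_zero)
qed auto

lemma pnull_minus: "pnull p X \<Longrightarrow> pnull p (\<lambda>n. - X n)"
  by (simp add: pnull_def)

lemma pnull_add:
  assumes "pnull p X" "pnull p Y"
  shows "pnull p (\<lambda>n. X n + Y n)"
  unfolding pnull_def
proof (rule tendsto_sandwich[OF _ _ tendsto_const])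
  show "(\<lambda>n. max (rat_pabs p (X n)) (rat_pabs p (Y n))) \<longlonglongrightarrow> 0"
    using tendsto_max[OF assms[unfolded pnull_def]] by simp
qed (auto simp: rat_pabs_add)

lemma pnull_mult_bounded:
  assumes "pcauchy p X" "pnull p Y"
  shows "pnull p (\<lambda>n. X n * Y n)"
proof -
  obtain A where A: "A > 0" "\<And>n. rat_pabs p (X n) \<le> A" by (rule pcauchy_bounded[OF assms(1)]) blast
  show ?thesis using A by (intro pnull_le[OF assms(2), of _ A])
      (auto simp: rat_pabs_mult mult_right_mono)
qed

lemma inverse_diff_pabs:
  assumes "x \<noteq> 0" "y \<noteq> 0"
  shows "rat_pabs p (inverse x - inverse y)
       = rat_pabs p (x - y) * inverse (rat_pabs p x) * inverse (rat_pabs p y)"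
proof -
  have "inverse x - inverse y = (y - x) * inverse x * inverse y"
    using assms by (simp add: field_simps)
  thus ?thesis
    by (simp only: rat_pabs_mult rat_pabs_inverse rat_pabs_minus_commute[of y x])
qed

lemma inverse_diff_pabs_le:
  assumes "b > 0" "rat_pabs p x > b" "rat_pabs p y > c" "c > 0"
  shows "rat_pabs p (inverse x - inverse y) \<le> inverse b * inverse c * rat_pabs p (x - y)"
proof -
  have nz: "x \<noteq> 0" "y \<noteq> 0" using assms by auto
  have "inverse (rat_pabs p x) * inverse (rat_pabs p y) \<le> inverse b * inverse c"
    using assms by (intro mult_mono le_imp_inverse_le) auto
  hence "rat_pabs p (x - y) * (inverse (rat_pabs p x) * inverse (rat_pabs p y))
      \<le> rat_pabs p (x - y) * (inverse b * inverse c)"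
    by (intro mult_left_mono) auto
  thus ?thesis using nz by (simp add: inverse_diff_pabs mult_ac)
qed

lemma pcauchy_inverse:
  assumes "pcauchy p X" "\<not> pnull p X"
  shows "pcauchy p (\<lambda>n. inverse (X n))"
  unfolding pcauchy_def
proof safe
  fix e :: real assume e: "e > 0"
  obtain b N where b: "b > 0" "\<And>n. n \<ge> N \<Longrightarrow> rat_pabs p (X n) > b"
    by (rule pcauchy_not_null[OF assms]) blast
  have "e * b * b > 0" using e b by simp
  then obtain M where M: "\<forall>m\<ge>M. \<forall>n\<ge>M. rat_pabs p (X m - X n) < e * b * b"
    using assms pcauchyD by meson
  have "rat_pabs p (inverse (X m) - inverse (X n)) < e" if mn: "m \<ge> max N M" "n \<ge> max N M" for m n
  proof -
    have "rat_pabs p (inverse (X m) - inverse (X n)) \<le> inverse b * inverse b * rat_pabs p (X m - X n)"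
      using b mn by (intro inverse_diff_pabs_le) auto
    also have "\<dots> < inverse b * inverse b * (e * b * b)"
      using M mn b by (intro mult_strict_left_mono) auto
    finally show ?thesis using b by (simp add: field_simps)
  qed
  thus "\<exists>N. \<forall>m\<ge>N. \<forall>n\<ge>N. rat_pabs p (inverse (X m) - inverse (X n)) < e" by blast
qed

lemma pnull_inverse_diff:
  assumes "pcauchy p X" "\<not> pnull p X" "pcauchy p Y" "\<not> pnull p Y" "pnull p (\<lambda>n. X n - Y n)"
  shows "pnull p (\<lambda>n. inverse (X n) - inverse (Y n))"
proof -
  obtain b N where b: "b > 0" "\<And>n. n \<ge> N \<Longrightarrow> rat_pabs p (X n) > b"
    using pcauchy_not_null[OF assms(1,2)] by metis
  obtain c M where c: "c > 0" "\<And>n. n \<ge> M \<Longrightarrow> rat_pabs p (Y n) > c"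
    using pcauchy_not_null[OF assms(3,4)] by metis
  have "eventually (\<lambda>n. n \<ge> max N M) sequentially" by (rule eventually_ge_at_top)
  hence "eventually (\<lambda>n. rat_pabs p (inverse (X n) - inverse (Y n))
      \<le> inverse b * inverse c * rat_pabs p (X n - Y n)) sequentially"
    by eventually_elim (use b c in \<open>auto intro!: inverse_diff_pabs_le\<close>)
  thus ?thesis by (rule pnull_le[OF assms(5)])
qed

lemma pnull_cong:
  assumes "pnull p (\<lambda>n. X n - Y n)"
  shows "pnull p X \<longleftrightarrow> pnull p Y"
  using pnull_add[OF assms, of Y] pnull_add[OF pnull_minus[OF assms], of X] by auto

lemma padic_rel_mult:
  assumes "padic_rel p X X'" "padic_rel p Y Y'"
  shows "padic_rel p (\<lambda>n. X n * Y n) (\<lambda>n. X' n * Y' n)"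
proof -
  have "X n * Y n - X' n * Y' n = X n * (Y n - Y' n) + Y' n * (X n - X' n)" for n
    by (simp add: algebra_simps)
  thus ?thesis using assms unfolding padic_rel_def
    by (simp add: pcauchy_mult pnull_add pnull_mult_bounded)
qed

lemma padic_rel_inverse:
  assumes "padic_rel p X Y"
  shows "padic_rel p (if pnull p X then (\<lambda>_. 0) else (\<lambda>n. inverse (X n)))
                     (if pnull p Y then (\<lambda>_. 0) else (\<lambda>n. inverse (Y n)))"
  using assms pnull_cong[of X Y] unfolding padic_rel_def
  by (auto simp: pcauchy_const pnull_0 pcauchy_inverse pnull_inverse_diff)

lemma padic_rel_lim:
  assumes "padic_rel p X Y"
  shows "lim (\<lambda>n. rat_pabs p (X n)) = lim (\<lambda>n. rat_pabs p (Y n))"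
proof -
  have X: "(\<lambda>n. rat_pabs p (X n)) \<longlonglongrightarrow> lim (\<lambda>n. rat_pabs p (X n))"
    using assms pcauchy_convergent by (simp add: padic_rel_def convergent_LIMSEQ_iff)
  have n: "(\<lambda>n. rat_pabs p (X n - Y n)) \<longlonglongrightarrow> 0" using assms by (simp add: padic_rel_def pnull_def)
  have "(\<lambda>n. rat_pabs p (X n) - rat_pabs p (Y n)) \<longlonglongrightarrow> 0"
    by (rule tendsto_rabs_zero_cancel, rule tendsto_sandwich[OF _ _ tendsto_const n])
       (auto simp: rat_pabs_triangle)
  from tendsto_diff[OF X this] have "(\<lambda>n. rat_pabs p (Y n)) \<longlonglongrightarrow> lim (\<lambda>n. rat_pabs p (X n))" by simp
  thus ?thesis by (rule limI[symmetric])
qed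

end


section \<open>The field of $p$-adic numbers\<close>

text \<open>
  The prime is the cardinality of the type argument (class \<^class>\<open>prime_card\<close>).
  As usual, the field is the completion of the rationals: Cauchy sequences with respect to
  the $p$-adic absolute value modulo null sequences.
\<close>

typedef (overloaded) 'p pseq = "{X. pcauchy CARD('p::prime_card) X}"
  using pcauchy_const[OF prime_card] by blast

setup_lifting type_definition_pseq

lift_definition pseq_rel :: "'p::prime_card pseq \<Rightarrow> 'p pseq \<Rightarrow> bool"
  is "\<lambda>X Y. pnull CARD('p) (\<lambda>n. X n - Y n)" .

lift_definition pseq_const :: "rat \<Rightarrow> 'p::prime_card pseq" is "\<lambda>c _. c"
  by (rule pcauchy_const[OF prime_card])

lift_definition pseq_add :: "'p::prime_card pseq \<Rightarrow> 'p pseq \<Rightarrow> 'p pseq"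
  is "\<lambda>X Y n. X n + Y n" by (rule pcauchy_add[OF prime_card])

lift_definition pseq_minus :: "'p::prime_card pseq \<Rightarrow> 'p pseq"
  is "\<lambda>X n. - X n" by (rule pcauchy_minus[OF prime_card])

lift_definition pseq_mult :: "'p::prime_card pseq \<Rightarrow> 'p pseq \<Rightarrow> 'p pseq"
  is "\<lambda>X Y n. X n * Y n" by (rule pcauchy_mult[OF prime_card])

lift_definition pseq_inverse :: "'p::prime_card pseq \<Rightarrow> 'p pseq"
  is "\<lambda>X. if pnull CARD('p) X then (\<lambda>_. 0) else (\<lambda>n. inverse (X n))"
  by (auto intro: pcauchy_const[OF prime_card] pcauchy_inverse[OF prime_card])

lift_definition pseq_abs :: "'p::prime_card pseq \<Rightarrow> real"
  is "\<lambda>X. lim (\<lambda>n. rat_pabs CARD('p) (X n))" .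

lemma equivp_pseq_rel: "equivp (pseq_rel :: 'p::prime_card pseq \<Rightarrow> _)"
proof (rule equivpI)
  show "reflp (pseq_rel :: 'p pseq \<Rightarrow> _)"
    unfolding reflp_def by transfer (simp add: pnull_0[OF prime_card])
  show "symp (pseq_rel :: 'p pseq \<Rightarrow> _)"
    unfolding symp_def by transfer (use pnull_minus[OF prime_card] in fastforce)
  show "transp (pseq_rel :: 'p pseq \<Rightarrow> _)"
    unfolding transp_def by transfer (use pnull_add[OF prime_card] in fastforce)
qed

quotient_type (overloaded) 'p padic = "'p::prime_card pseq" / pseq_rel
  by (rule equivp_pseq_rel)

instantiation padic :: (prime_card) field
begin

lift_definition zero_padic :: "'a padic" is "pseq_const 0" .
lift_definition one_padic :: "'a padic" is "pseq_const 1" .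

lift_definition plus_padic :: "'a padic \<Rightarrow> 'a padic \<Rightarrow> 'a padic" is pseq_add
proof (transfer, goal_cases)
  case (1 X X' Y Y')
  have "(X n + Y n) - (X' n + Y' n) = (X n - X' n) + (Y n - Y' n)" for n by simp
  thus ?case using pnull_add[OF prime_card 1(5,6)] by presburger
qed

lift_definition uminus_padic :: "'a padic \<Rightarrow> 'a padic" is pseq_minus
proof (transfer, goal_cases)
  case (1 X Y)
  thus ?case using pnull_minus[OF prime_card 1(3)] by simp
qed

lift_definition times_padic :: "'a padic \<Rightarrow> 'a padic \<Rightarrow> 'a padic" is pseq_mult
proof (transfer, goal_cases)
  case (1 X X' Y Y')
  thus ?case using padic_rel_mult[OF prime_card[where 'a = 'a], of X X' Y Y'] by (simp add: padic_rel_def)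
qed

lift_definition inverse_padic :: "'a padic \<Rightarrow> 'a padic" is pseq_inverse
proof (transfer, goal_cases)
  case (1 X Y)
  thus ?case using padic_rel_inverse[OF prime_card[where 'a = 'a], of X Y] by (simp only: padic_rel_def)
qed

definition minus_padic :: "'a padic \<Rightarrow> 'a padic \<Rightarrow> 'a padic" where "minus_padic x y = x + - y"
definition divide_padic :: "'a padic \<Rightarrow> 'a padic \<Rightarrow> 'a padic" where
  "divide_padic x y = x * inverse y"

instance
proof
  note null0 = pnull_0[OF prime_card]
  fix a b c :: "'a padic"
  show "a + b = b + a" by transfer (transfer, simp add: null0 add.commute)
  show "(a + b) + c = a + (b + c)" by transfer (transfer, simp add: null0 add.assoc)
  show "0 + a = a" by transfer (transfer, simp add: null0)
  show "- a + a = 0" by transfer (transfer, simp add: null0)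
  show "a - b = a + - b" by (rule minus_padic_def)
  show "(a * b) * c = a * (b * c)" by transfer (transfer, simp add: null0 mult.assoc)
  show "a * b = b * a" by transfer (transfer, simp add: null0 mult.commute)
  show "1 * a = a" by transfer (transfer, simp add: null0)
  show "(a + b) * c = a * c + b * c" by transfer (transfer, simp add: null0 algebra_simps)
  show "(0 :: 'a padic) \<noteq> 1"
  proof
    assume "(0 :: 'a padic) = 1"
    hence "pseq_rel (pseq_const 0) (pseq_const 1 :: 'a pseq)"
      by (simp add: zero_padic_def one_padic_def padic.abs_eq_iff)
    hence "pnull CARD('a) (\<lambda>_. 0 - 1)" by transfer
    thus False by (simp add: pnull_def LIMSEQ_const_iff rat_pabs_eq_0[OF prime_card])
  qed
  show "inverse a * a = 1" if "a \<noteq> 0" using that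
  proof (transfer, transfer, goal_cases)
    case (1 X)
    hence X: "\<not> pnull CARD('a) X" by simp
    obtain b N where b: "b > 0" "\<And>n. n \<ge> N \<Longrightarrow> rat_pabs CARD('a) (X n) > b"
      using pcauchy_not_null[OF prime_card 1(1) X] by metis
    have "X n \<noteq> 0" if "n \<ge> N" for n
      using b(1) b(2)[OF that] by (auto simp: rat_pabs_0[OF prime_card])
    hence "eventually (\<lambda>n. rat_pabs CARD('a) (inverse (X n) * X n - 1) = 0) sequentially"
      unfolding eventually_sequentially
      by (intro exI[of _ N]) (auto simp: rat_pabs_0[OF prime_card])
    hence "pnull CARD('a) (\<lambda>n. inverse (X n) * X n - 1)"
      unfolding pnull_def by (rule tendsto_eventually)
    thus ?case using X by simp
  qed
  show "a div b = a * inverse b" by (rule divide_padic_def)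
  show "inverse (0 :: 'a padic) = 0" by transfer (transfer, simp add: null0)
qed

end

lift_definition pnorm :: "'p::prime_card padic \<Rightarrow> real" is pseq_abs
proof (transfer, goal_cases)
  case (1 X Y)
  thus ?case by (intro padic_rel_lim[OF prime_card]) (simp add: padic_rel_def)
qed

lemma pseq_abs_lim:
  assumes "pcauchy CARD('p::prime_card) X"
  shows "(\<lambda>n. rat_pabs CARD('p) (X n)) \<longlonglongrightarrow> lim (\<lambda>n. rat_pabs CARD('p) (X n))"
  using pcauchy_convergent[OF prime_card assms] by (simp add: convergent_LIMSEQ_iff)

lemma pnorm_eq_0 [simp]: "pnorm x = 0 \<longleftrightarrow> x = 0" for x :: "'p::prime_card padic"
proof (transfer, transfer, goal_cases)
  case (1 X)
  show ?case
    unfolding diff_zero pnull_def using pseq_abs_lim[OF 1] limI by metis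
qed

lemma pnorm_nonneg [simp]: "pnorm x \<ge> 0" for x :: "'p::prime_card padic"
proof (transfer, transfer, goal_cases)
  case (1 X)
  show ?case using pseq_abs_lim[OF 1] by (rule LIMSEQ_le_const) (auto simp: rat_pabs_nonneg[OF prime_card])
qed

lemma pnorm_0 [simp]: "pnorm (0 :: 'p::prime_card padic) = 0"
  by simp

lemma pnorm_mult: "pnorm (x * y) = pnorm x * pnorm y" for x y :: "'p::prime_card padic"
proof (transfer, transfer, goal_cases)
  case (1 X Y)
  show ?case
    using tendsto_mult[OF pseq_abs_lim[OF 1(1)] pseq_abs_lim[OF 1(2)]]
    by (intro limI) (simp add: rat_pabs_mult[OF prime_card])
qed

lemma pnorm_minus [simp]: "pnorm (- x) = pnorm x" for x :: "'p::prime_card padic"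
  by transfer (transfer, simp add: rat_pabs_minus[OF prime_card])

text \<open>The ultrametric inequality.\<close>

lemma pnorm_add: "pnorm (x + y) \<le> max (pnorm x) (pnorm y)" for x y :: "'p::prime_card padic"
proof (transfer, transfer, goal_cases)
  case (1 X Y)
  show ?case
    by (rule LIMSEQ_le[OF pseq_abs_lim[OF pcauchy_add[OF prime_card 1]]
          tendsto_max[OF pseq_abs_lim[OF 1(1)] pseq_abs_lim[OF 1(2)]]])
       (auto simp: rat_pabs_add[OF prime_card])
qed

instantiation padic :: (prime_card) metric_space
begin

definition dist_padic :: "'a padic \<Rightarrow> 'a padic \<Rightarrow> real" where
  "dist_padic x y = pnorm (x - y)"

definition uniformity_padic :: "('a padic \<times> 'a padic) filter" where
  "uniformity_padic = (INF e\<in>{0<..}. principal {(x, y). dist x y < e})"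

definition open_padic :: "'a padic set \<Rightarrow> bool" where
  "open_padic U \<longleftrightarrow> (\<forall>x\<in>U. eventually (\<lambda>(x', y). x' = x \<longrightarrow> y \<in> U) uniformity)"

instance
proof
  fix x y z :: "'a padic"
  show "dist x y = 0 \<longleftrightarrow> x = y" by (simp add: dist_padic_def)
  have "pnorm (y - z) = pnorm (z - y)" using pnorm_minus[of "y - z"] by simp
  hence "pnorm (x - y) \<le> max (pnorm (x - z)) (pnorm (y - z))"
    using pnorm_add[of "x - z" "z - y"] by simp
  thus "dist x y \<le> dist x z + dist y z"
    using pnorm_nonneg[of "x - z"] pnorm_nonneg[of "y - z"]
    unfolding dist_padic_def by linarith
qed (simp_all add: uniformity_padic_def open_padic_def)

end

lemma of_nat_padic: "of_nat n = abs_padic (pseq_const (of_nat n) :: 'p::prime_card pseq)"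
proof (induction n)
  case (Suc n)
  have "pseq_rel (pseq_add (pseq_const 1) (pseq_const (of_nat n)))
          (pseq_const (of_nat (Suc n)) :: 'p pseq)"
    by transfer (simp add: pnull_0[OF prime_card])
  thus ?case using Suc
    by (simp add: one_padic.abs_eq plus_padic.abs_eq padic.abs_eq_iff)
qed (simp add: zero_padic.abs_eq)

instance padic :: (prime_card) field_char_0
proof
  show "inj (of_nat :: nat \<Rightarrow> 'a padic)"
  proof (rule injI)
    fix m n assume "of_nat m = (of_nat n :: 'a padic)"
    hence "pseq_rel (pseq_const (of_nat m)) (pseq_const (of_nat n) :: 'a pseq)"
      by (simp add: of_nat_padic padic.abs_eq_iff)
    hence "pnull CARD('a) (\<lambda>_. of_nat m - of_nat n)" by transfer
    thus "m = n" by (simp add: pnull_def LIMSEQ_const_iff rat_pabs_eq_0[OF prime_card])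
  qed
qed

lemma of_int_padic: "of_int n = abs_padic (pseq_const (of_int n) :: 'p::prime_card pseq)"
proof (cases n rule: int_cases2)
  case (nonpos k)
  have "pseq_rel (pseq_minus (pseq_const (of_nat k))) (pseq_const (- of_nat k) :: 'p pseq)"
    by transfer (simp add: pnull_0[OF prime_card])
  thus ?thesis using nonpos by (simp add: of_nat_padic uminus_padic.abs_eq padic.abs_eq_iff)
qed (simp add: of_nat_padic)

lemma of_rat_padic: "of_rat q = abs_padic (pseq_const q :: 'p::prime_card pseq)"
proof -
  obtain a b where q: "b \<noteq> 0" "q = of_int a / of_int b"
    using rat_frac_cases[OF prime_card[where 'a = 'p]] by metis
  have "pseq_rel (pseq_mult (pseq_const q) (pseq_const (of_int b))) (pseq_const (of_int a) :: 'p pseq)"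
    using q by transfer (simp add: pnull_0[OF prime_card])
  hence "abs_padic (pseq_const q :: 'p pseq) * of_int b = of_int a"
    by (simp add: of_int_padic times_padic.abs_eq padic.abs_eq_iff)
  thus ?thesis using q by (simp add: of_rat_divide divide_eq_eq)
qed

lemma pnorm_of_rat: "pnorm (of_rat q :: 'p::prime_card padic) = rat_pabs CARD('p) q"
  unfolding of_rat_padic pnorm.abs_eq by transfer (rule limI[OF tendsto_const])

lemma of_rat_dense_padic:
  fixes x :: "'p::prime_card padic"
  assumes "e > 0"
  shows "\<exists>q. dist x (of_rat q) < e"
proof -
  obtain S where S: "x = abs_padic S" by (metis Quotient3_abs_rep Quotient3_padic)
  define X where "X = Rep_pseq S"
  have X: "pcauchy CARD('p) X" using Rep_pseq[of S] by (simp add: X_def)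
  obtain N where N: "\<forall>m\<ge>N. \<forall>n\<ge>N. rat_pabs CARD('p) (X m - X n) < e / 2"
    using pcauchyD[OF prime_card X, of "e / 2"] assms by auto
  have c: "pcauchy CARD('p) (\<lambda>n. X n + - X N)"
    by (intro pcauchy_add[OF prime_card] X pcauchy_const[OF prime_card])
  have "dist x (of_rat (X N)) = pseq_abs (pseq_add S (pseq_minus (pseq_const (X N))))"
    by (simp add: dist_padic_def minus_padic_def S of_rat_padic uminus_padic.abs_eq
        plus_padic.abs_eq pnorm.abs_eq)
  also have "\<dots> = lim (\<lambda>n. rat_pabs CARD('p) (X n + - X N))"
    by (simp add: pseq_abs.rep_eq pseq_add.rep_eq pseq_minus.rep_eq pseq_const.rep_eq X_def)
  also have "\<dots> \<le> e / 2"
    using N by (intro LIMSEQ_le_const2[OF pseq_abs_lim[OF c]] exI[of _ N]) (auto intro: less_imp_le)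
  also have "\<dots> < e" using assms by simp
  finally show ?thesis by blast
qed

lemma pseq_LIMSEQ_padic:
  "(\<lambda>n. of_rat (Rep_pseq S n)) \<longlonglongrightarrow> (abs_padic S :: 'p::prime_card padic)"
proof (rule metric_LIMSEQ_I)
  fix e :: real assume e: "e > 0"
  define X where "X = Rep_pseq S"
  have X: "pcauchy CARD('p) X" using Rep_pseq[of S] by (simp add: X_def)
  obtain N where N: "\<forall>m\<ge>N. \<forall>n\<ge>N. rat_pabs CARD('p) (X m - X n) < e / 2"
    using pcauchyD[OF prime_card X, of "e / 2"] e by auto
  have "dist (of_rat (X k)) (abs_padic S) < e" if k: "k \<ge> N" for k
  proof -
    have c: "pcauchy CARD('p) (\<lambda>n. X n + - X k)"
      by (intro pcauchy_add[OF prime_card] X pcauchy_const[OF prime_card])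
    have "dist (abs_padic S) (of_rat (X k)) = pseq_abs (pseq_add S (pseq_minus (pseq_const (X k))))"
      by (simp add: dist_padic_def minus_padic_def of_rat_padic uminus_padic.abs_eq
          plus_padic.abs_eq pnorm.abs_eq)
    also have "\<dots> = lim (\<lambda>n. rat_pabs CARD('p) (X n + - X k))"
      by (simp add: pseq_abs.rep_eq pseq_add.rep_eq pseq_minus.rep_eq pseq_const.rep_eq X_def)
    also have "\<dots> \<le> e / 2"
      using N k by (intro LIMSEQ_le_const2[OF pseq_abs_lim[OF c]] exI[of _ N]) (auto intro: less_imp_le)
    also have "\<dots> < e" using e by simp
    finally show ?thesis by (simp add: dist_commute)
  qed
  thus "\<exists>N. \<forall>n\<ge>N. dist (of_rat (Rep_pseq S n)) (abs_padic S) < e"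
    unfolding X_def by blast
qed

instance padic :: (prime_card) complete_space
proof
  fix X :: "nat \<Rightarrow> 'a padic" assume X: "Cauchy X"
  define q where "q n = (SOME q. dist (X n) (of_rat q) < inverse (real (Suc n)))" for n
  have q: "dist (X n) (of_rat (q n)) < inverse (real (Suc n))" for n
    unfolding q_def by (rule someI_ex, rule of_rat_dense_padic) simp
  have "(\<lambda>n. dist (of_rat (q n)) (X n)) \<longlonglongrightarrow> 0"
    by (rule tendsto_sandwich[OF _ _ tendsto_const LIMSEQ_inverse_real_of_nat])
       (use q in \<open>auto simp: dist_commute intro!: always_eventually less_imp_le\<close>)
  hence d: "(\<lambda>n. dist (X n) (of_rat (q n))) \<longlonglongrightarrow> 0" by (simp add: dist_commute)
  have "pcauchy CARD('a) q"
    unfolding pcauchy_def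
  proof safe
    fix e :: real assume e: "e > 0"
    obtain N where N: "\<And>m n. m \<ge> N \<Longrightarrow> n \<ge> N \<Longrightarrow> dist (X m) (X n) < e / 3"
      using metric_CauchyD[OF X, of "e / 3"] e by auto
    obtain M where M: "\<And>n. n \<ge> M \<Longrightarrow> dist (X n) (of_rat (q n)) < e / 3"
      using order_tendstoD(2)[OF d, of "e / 3"] e by (auto simp: eventually_sequentially)
    have "rat_pabs CARD('a) (q m - q n) < e" if mn: "m \<ge> max N M" "n \<ge> max N M" for m n
    proof -
      have "rat_pabs CARD('a) (q m - q n) = dist (of_rat (q m) :: 'a padic) (of_rat (q n))"
        by (simp add: dist_padic_def pnorm_of_rat flip: of_rat_diff)
      also have "\<dots> \<le> dist (X m) (of_rat (q m)) + dist (X m) (X n) + dist (X n) (of_rat (q n))"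
        using dist_triangle[of "of_rat (q m)" "of_rat (q n)" "X m"]
          dist_triangle[of "X m" "of_rat (q n)" "X n"] by (simp add: dist_commute)
      also have "\<dots> < e" using N[of m n] M[of m] M[of n] mn by simp
      finally show ?thesis .
    qed
    thus "\<exists>N. \<forall>m\<ge>N. \<forall>n\<ge>N. rat_pabs CARD('a) (q m - q n) < e" by blast
  qed
  hence r: "Rep_pseq (Abs_pseq q :: 'a pseq) = q" by (simp add: Abs_pseq_inverse)
  have lim: "(\<lambda>n. of_rat (q n)) \<longlonglongrightarrow> (abs_padic (Abs_pseq q) :: 'a padic)"
    using pseq_LIMSEQ_padic[of "Abs_pseq q :: 'a pseq"] by (simp add: r)
  have "X \<longlonglongrightarrow> abs_padic (Abs_pseq q)"
  proof (rule metric_LIMSEQ_I)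
    fix e :: real assume e: "e > 0"
    have "eventually (\<lambda>n. dist (X n) (of_rat (q n)) < e / 2) sequentially"
      using order_tendstoD(2)[OF d, of "e / 2"] e by simp
    moreover have "eventually (\<lambda>n. dist (of_rat (q n)) (abs_padic (Abs_pseq q) :: 'a padic) < e / 2) sequentially"
      using tendstoD[OF lim, of "e / 2"] e by simp
    ultimately have "eventually (\<lambda>n. dist (X n) (abs_padic (Abs_pseq q)) < e) sequentially"
      by eventually_elim (metis dist_triangle_half_l dist_commute)
    thus "\<exists>N. \<forall>n\<ge>N. dist (X n) (abs_padic (Abs_pseq q)) < e"
      by (simp add: eventually_sequentially)
  qed
  thus "convergent X" by (auto simp: convergent_def)
qed

definition padic_ints :: "'p::prime_card padic set" where
  "padic_ints = {x. pnorm x \<le> 1}"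


section \<open>Haar measure and the standard additive character\<close>

text \<open>
  Normalised Haar measure on the additive group: there is exactly one Borel measure with these
  properties. It is automatically finite on compact sets and regular, since the normalisation
  and translation invariance give $p^n \<int>_p$ the measure $p^{-n}$.
\<close>

definition padic_haar :: "'p::prime_card padic measure \<Rightarrow> bool" where
  "padic_haar M \<longleftrightarrow>
     sets M = sets borel \<and>
     (\<forall>x. \<forall>A\<in>sets borel. emeasure M ((\<lambda>y. x + y) ` A) = emeasure M A) \<and>
     emeasure M padic_ints = 1"

text \<open>
  The value does not depend on the choice of the integer \<open>r\<close>, which is
  determined modulo $p^n$.
\<close>

definition padic_char :: "'p::prime_card padic \<Rightarrow> complex" where
  "padic_char x =
     (let p = CARD('p);
          n = (LEAST n. of_nat p ^ n * x \<in> padic_ints);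
          r = (SOME r::int. \<exists>z\<in>padic_ints. of_int r - of_nat p ^ n * x = of_nat p ^ n * z)
      in exp (2 * of_real pi * \<i> * of_int r / of_nat p ^ n))"


section \<open>The measures attached to a polynomial map\<close>

definition Ess :: "'p::prime_card padic poly \<Rightarrow> real" where
  "Ess f = Max (insert 0
     {log (real CARD('p)) (pnorm (Polynomial.coeff f i) / pnorm (lead_coeff f)) | i.
        i < Polynomial.degree f \<and> Polynomial.coeff f i \<noteq> 0})"

text \<open>
  The parameter \<open>L\<close> is the normalising constant; polynomials and frequencies are indexed by
  \<open>1, \<dots>, m\<close>.
\<close>

definition muT_hat ::
  "'p::prime_card padic measure \<Rightarrow> real \<Rightarrow> nat \<Rightarrow> nat \<Rightarrow> nat \<Rightarrow> (nat \<Rightarrow> 'p padic poly) \<Rightarrow> (nat \<Rightarrow> 'p padic) \<Rightarrow> complex"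
where
  "muT_hat M L a T m f lam =
     1 / of_real L *
     (LINT s : {s. real CARD('p) ^ a \<le> pnorm s \<and> pnorm s \<le> real CARD('p) ^ T} | M.
        (padic_char (\<Sum>i=1..m. lam i * poly (f i) s) + cnj (padic_char (\<Sum>i=1..m. lam i * poly (f i) s)))
          / of_real (pnorm s))"

end

theory Submission
  imports Defs
begin

text \<open>
  Write \<open>g = \<Sum>i. lam i * f i = \<Sum>l. c\<^sub>l s\<^sup>l\<close> and split the integral over the spheres
  \<open>\<bar>s\<bar> = p\<^sup>j\<close>, where \<open>a \<le> j \<le> T\<close>. Each sphere contributes at least \<open>-2\<close>, so it is enough to
  bound the number of spheres with a negative contribution by \<open>3D + 2\<close>, where \<open>D = deg f\<^sub>1\<close>.
  Let \<open>F(j)\<close> be the maximum of \<open>\<bar>c\<^sub>l\<bar> p\<^sup>j\<^sup>l\<close> over \<open>l \<ge> 1\<close>. Since \<open>a\<close> exceeds all the \<open>Ess f\<^sub>i\<close>, the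
  constant coefficient does not exceed \<open>F(j)\<close>, so the phase is trivial when \<open>F(j) \<le> 1\<close>.
  As \<open>F\<close> grows at least by the factor \<open>p\<close> in each step, \<open>1 < F(j) < p\<^sup>2\<^sup>D\<^sup>+\<^sup>2\<close> happens for at most
  \<open>2D + 2\<close> values of \<open>j\<close>. For larger \<open>F(j)\<close> the contribution vanishes by non-stationary phase
  whenever a single term dominates \<open>s g'(s)\<close> on the sphere, and ties between two terms occur only
  at the at most \<open>D\<close> corners of a maximum of lines with slopes \<open>1, \<dots>, D\<close>.
\<close>

section \<open>The absolute value\<close>

lemma card_gt_1: "1 < real CARD('p::prime_card)"
  using p_gt_1[OF prime_card] .

lemma pnorm_eq_dist: "pnorm x = dist x 0"
  by (simp add: dist_padic_def)

lemma pnorm_pos: "x \<noteq> 0 \<Longrightarrow> 0 < pnorm x" for x :: "'p::prime_card padic"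
  by (simp add: less_le)

lemma pnorm_1 [simp]: "pnorm (1 :: 'p::prime_card padic) = 1"
  using pnorm_of_rat[of 1, where 'p = 'p] rat_pabs_1[OF prime_card, where 'a1 = 'p] by simp

lemma pnorm_inverse: "pnorm (inverse x) = inverse (pnorm x)" for x :: "'p::prime_card padic"
proof (cases "x = 0")
  case False
  then have "pnorm x * pnorm (inverse x) = 1"
    by (simp flip: pnorm_mult)
  then show ?thesis by (metis inverse_unique)
qed simp

lemma pnorm_divide: "pnorm (x / y) = pnorm x / pnorm y" for x y :: "'p::prime_card padic"
  by (simp add: divide_inverse pnorm_mult pnorm_inverse)

lemma pnorm_power: "pnorm (x ^ n) = pnorm x ^ n" for x :: "'p::prime_card padic"
  by (induction n) (simp_all add: pnorm_mult)

lemma pnorm_diff: "pnorm (x - y) \<le> max (pnorm x) (pnorm y)" for x y :: "'p::prime_card padic"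
  using pnorm_add[of x "- y"] by simp

lemma pnorm_diff_commute: "pnorm (x - y) = pnorm (y - x)" for x y :: "'p::prime_card padic"
  using pnorm_minus[of "x - y"] by simp

text \<open>If \<open>x + y\<close> were smaller than \<open>x\<close>, the ultrametric inequality
  for \<open>x = (x + y) - y\<close> would make \<open>x\<close> smaller than itself.\<close>

lemma pnorm_add_eq_left:
  fixes x y :: "'p::prime_card padic"
  assumes "pnorm y < pnorm x"
  shows "pnorm (x + y) = pnorm x"
  using assms pnorm_add[of x y] pnorm_diff[of "x + y" y] by auto

lemma pnorm_sum_le:
  fixes g :: "'a \<Rightarrow> 'p::prime_card padic"
  assumes "0 \<le> B" "\<And>i. i \<in> A \<Longrightarrow> pnorm (g i) \<le> B"
  shows "pnorm (sum g A) \<le> B"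
  using assms(2)
proof (induction A rule: infinite_finite_induct)
  case (insert x F)
  then have "pnorm (g x) \<le> B" "pnorm (sum g F) \<le> B" by auto
  then show ?case using insert by (auto intro: order_trans[OF pnorm_add])
qed (use assms(1) in auto)

lemma pnorm_sum_less:
  fixes g :: "'a \<Rightarrow> 'p::prime_card padic"
  assumes "0 < B" "\<And>i. i \<in> A \<Longrightarrow> pnorm (g i) < B"
  shows "pnorm (sum g A) < B"
  using assms(2)
proof (induction A rule: infinite_finite_induct)
  case (insert x F)
  then have "pnorm (g x) < B" "pnorm (sum g F) < B" by auto
  then show ?case using insert by (auto intro: le_less_trans[OF pnorm_add])
qed (use assms(1) in auto)

lemma pnorm_sum_dominant:
  fixes g :: "'a \<Rightarrow> 'p::prime_card padic"
  assumes "finite A" "k \<in> A" "0 < pnorm (g k)"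
    and "\<And>i. i \<in> A \<Longrightarrow> i \<noteq> k \<Longrightarrow> pnorm (g i) < pnorm (g k)"
  shows "pnorm (sum g A) = pnorm (g k)"
proof -
  have "sum g A = g k + sum g (A - {k})"
    using assms by (simp add: sum.remove)
  moreover have "pnorm (sum g (A - {k})) < pnorm (g k)"
    using assms by (intro pnorm_sum_less) auto
  ultimately show ?thesis by (simp add: pnorm_add_eq_left)
qed

section \<open>Absolute values of integers, and approximation by integers\<close>

lemma pnorm_of_int:
  assumes "z \<noteq> 0"
  shows "pnorm (of_int z :: 'p::prime_card padic)
    = real CARD('p) powi (- int (multiplicity (int CARD('p)) z))"
proof -
  have "rat_val CARD('p) (of_int z) = int (multiplicity (int CARD('p)) z)"
    using rat_val_frac[OF prime_card assms one_neq_zero] by simp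
  then show ?thesis
    using pnorm_of_rat[of "of_int z", where 'p = 'p] assms by (simp add: rat_pabs_def)
qed

lemma pnorm_card [simp]:
  "pnorm (of_nat CARD('p) :: 'p::prime_card padic) = inverse (real CARD('p))"
proof -
  have "multiplicity (int CARD('p)) (int CARD('p)) = 1"
    using card_gt_1[where 'p = 'p] by (intro multiplicity_self) auto
  then show ?thesis
    using pnorm_of_int[of "int CARD('p)", where 'p = 'p] by (simp add: power_int_minus)
qed

lemma pnorm_card_power [simp]:
  "pnorm (of_nat CARD('p) ^ n :: 'p::prime_card padic) = inverse (real CARD('p) ^ n)"
  by (simp add: pnorm_power power_inverse)

lemma pnorm_of_int_le_1: "pnorm (of_int z :: 'p::prime_card padic) \<le> 1"
proof (cases "z = 0")
  case False
  then show ?thesis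
    using card_gt_1[where 'p = 'p]
    by (simp add: pnorm_of_int power_int_minus inverse_le_1_iff)
qed simp

lemma pnorm_of_nat_le_1: "pnorm (of_nat n :: 'p::prime_card padic) \<le> 1"
  using pnorm_of_int_le_1[of "int n"] by simp

lemma pnorm_of_int_le_iff:
  "pnorm (of_int z :: 'p::prime_card padic) \<le> inverse (real CARD('p) ^ n)
    \<longleftrightarrow> int CARD('p) ^ n dvd z"
proof (cases "z = 0")
  case False
  have nu: "\<not> is_unit (int CARD('p))"
    using card_gt_1[where 'p = 'p] by auto
  have "pnorm (of_int z :: 'p padic)
      = inverse (real CARD('p) ^ multiplicity (int CARD('p)) z)"
    using False by (simp add: pnorm_of_int power_int_minus)
  then show ?thesis
    using card_gt_1[where 'p = 'p] False nu
    by (simp add: power_dvd_iff_le_multiplicity)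
qed simp

text \<open>If \<open>p ^ v\<close> divides \<open>n\<close>, then
  \<open>p ^ v <= n <= d < p ^ d\<close>, hence \<open>v < d\<close>. This limits the loss when a
  coefficient of degree \<open>n\<close> is multiplied by \<open>n\<close> in passing from
  \<open>g(s)\<close> to \<open>s g'(s)\<close>.\<close>

lemma pnorm_of_nat_ge:
  assumes "0 < n" "n \<le> d"
  shows "inverse (real CARD('p) ^ d) \<le> pnorm (of_nat n :: 'p::prime_card padic)"
proof -
  let ?v = "multiplicity (int CARD('p)) (int n)"
  have "int CARD('p) ^ ?v dvd int n" by (rule multiplicity_dvd)
  then have "int CARD('p) ^ ?v \<le> int n" using assms by (intro zdvd_imp_le) auto
  moreover have "int d < int CARD('p) ^ d"
  proof -
    have "d < 2 ^ d" by (rule less_exp)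
    also have "2 ^ d \<le> CARD('p) ^ d"
      using card_gt_1[where 'p = 'p] by (intro power_mono) auto
    finally show ?thesis by (simp flip: of_nat_power)
  qed
  ultimately have "int CARD('p) ^ ?v < int CARD('p) ^ d" using assms by linarith
  then have "?v < d" using card_gt_1[where 'p = 'p] by (simp add: power_strict_increasing_iff)
  then have "real CARD('p) ^ ?v \<le> real CARD('p) ^ d"
    using card_gt_1[where 'p = 'p] by (intro power_increasing) auto
  then show ?thesis
    using pnorm_of_int[of "int n", where 'p = 'p] assms card_gt_1[where 'p = 'p]
    by (simp add: power_int_minus le_imp_inverse_le)
qed

text \<open>A rational number closer to \<open>x\<close> than \<open>pnorm x\<close> has the same
  absolute value as \<open>x\<close>, and nonzero rationals have powers of \<open>p\<close> as
  absolute values.\<close>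

lemma pnorm_value_group:
  fixes x :: "'p::prime_card padic"
  assumes "x \<noteq> 0"
  obtains k where "pnorm x = real CARD('p) powi k"
proof -
  obtain q where q: "dist x (of_rat q) < pnorm x"
    using of_rat_dense_padic[OF pnorm_pos[OF assms]] by blast
  then have "pnorm (of_rat q - x) < pnorm x"
    by (simp add: dist_padic_def pnorm_diff_commute)
  then have "pnorm (of_rat q :: 'p padic) = pnorm x"
    using pnorm_add_eq_left[of "of_rat q - x" x] by simp
  then have "pnorm x = rat_pabs CARD('p) q" by (simp add: pnorm_of_rat)
  also have "\<dots> = real CARD('p) powi (- rat_val CARD('p) q)"
    using calculation pnorm_pos[OF assms] by (auto simp: rat_pabs_def)
  finally show ?thesis by (rule that)
qed

text \<open>Density of the integers in the p-adic integers. A rational \<open>u / v\<close> near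
  \<open>x\<close> in lowest terms is itself integral, so \<open>p\<close> cannot divide
  \<open>v\<close>; replacing \<open>1 / v\<close> by an inverse \<open>w\<close> of
  \<open>v\<close> modulo \<open>p ^ n\<close> gives the integer \<open>u * w\<close>.\<close>

lemma padic_int_approx:
  fixes x :: "'p::prime_card padic"
  assumes "pnorm x \<le> 1"
  obtains r :: int where "pnorm (of_int r - x) \<le> inverse (real CARD('p) ^ n)"
proof -
  let ?p = "int CARD('p)" and ?e = "inverse (real CARD('p) ^ n)"
  have e: "0 < ?e" "?e \<le> 1"
    using card_gt_1[where 'p = 'p] by (auto simp: inverse_le_1_iff)
  obtain q where q: "dist x (of_rat q) < ?e" using of_rat_dense_padic[OF e(1)] by blast
  obtain u v where uv: "quotient_of q = (u, v)" by (cases "quotient_of q")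
  have v: "0 < v" and cop: "coprime u v" and quv: "q = of_int u / of_int v"
    using quotient_of_denom_pos[OF uv] quotient_of_coprime[OF uv] quotient_of_div[OF uv] by auto
  have q': "of_rat q = (of_int u / of_int v :: 'p padic)" using quv by (simp add: of_rat_divide)
  have xq: "pnorm (x - of_rat q) < ?e" using q by (simp add: dist_padic_def)
  have q1: "pnorm (of_rat q :: 'p padic) \<le> 1"
    using pnorm_diff[of x "x - of_rat q"] xq e assms by simp
  \<comment> \<open>Otherwise \<open>u = q * v\<close> would have absolute value at most
    \<open>1 / p\<close>, and \<open>p\<close> would be a common divisor of \<open>u\<close> and
    \<open>v\<close>.\<close>
  have nd: "\<not> ?p dvd v"
  proof
    assume pv: "?p dvd v"
    have pr: "prime ?p" using prime_card[where 'a = 'p] by simp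
    have "pnorm (of_int v :: 'p padic) \<le> inverse (real CARD('p))"
      using pnorm_of_int_le_iff[of v 1, where 'p = 'p] pv by simp
    moreover have "inverse (real CARD('p)) < 1"
      using card_gt_1[where 'p = 'p] by (simp add: inverse_less_1_iff)
    moreover have "pnorm (of_int u :: 'p padic) = pnorm (of_rat q :: 'p padic) * pnorm (of_int v :: 'p padic)"
      using v by (simp add: q' flip: pnorm_mult)
    moreover have "pnorm (of_rat q :: 'p padic) * pnorm (of_int v :: 'p padic)
        \<le> 1 * pnorm (of_int v :: 'p padic)"
      using q1 by (intro mult_right_mono) auto
    ultimately have "pnorm (of_int u :: 'p padic) \<le> inverse (real CARD('p) ^ 1)"
      by simp
    then have "?p dvd u" unfolding pnorm_of_int_le_iff by simp
    with pv cop pr show False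
      by (meson coprime_common_divisor not_prime_unit)
  qed
  have "\<not> pnorm (of_int v :: 'p padic) \<le> inverse (real CARD('p) ^ 1)"
    using nd unfolding pnorm_of_int_le_iff by simp
  moreover have "multiplicity ?p v = 0" using nd by (rule not_dvd_imp_multiplicity_0)
  ultimately have v1: "pnorm (of_int v :: 'p padic) = 1"
    using v by (simp add: pnorm_of_int)
  have "coprime v (?p ^ n)"
    using nd prime_card[where 'a = 'p]
    by (metis coprime_commute coprime_power_right_iff prime_imp_coprime prime_int_nat_transfer nat_int of_nat_0_le_iff)
  then obtain w where w: "[v * w = 1] (mod ?p ^ n)"
    using cong_solve_coprime_int by blast
  then have "?p ^ n dvd 1 - v * w" by (metis cong_iff_dvd_diff cong_sym)
  then have "pnorm (of_int (1 - v * w) :: 'p padic) \<le> ?e" by (simp only: pnorm_of_int_le_iff)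
  moreover have "of_rat q - of_int (u * w) = of_rat q * (of_int (1 - v * w) :: 'p padic)"
    using v by (simp add: q' field_simps)
  moreover have "pnorm (of_rat q :: 'p padic) * pnorm (of_int (1 - v * w) :: 'p padic)
      \<le> 1 * pnorm (of_int (1 - v * w) :: 'p padic)"
    using q1 by (intro mult_right_mono) auto
  ultimately have "pnorm (of_rat q - of_int (u * w) :: 'p padic) \<le> ?e"
    by (simp add: pnorm_mult)
  then have "pnorm (x - of_int (u * w)) \<le> ?e"
    using pnorm_add[of "x - of_rat q" "of_rat q - of_int (u * w)"] xq by simp
  then show ?thesis using that[of "u * w"] by (simp only: pnorm_diff_commute)
qed

section \<open>The additive character\<close>

lemma exp_padic_eq:
  assumes "0 < p" "int p ^ n dvd r - s"
  shows "exp (2 * of_real pi * \<i> * of_int r / of_nat p ^ n)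
       = exp (2 * of_real pi * \<i> * of_int s / of_nat p ^ n)"
proof -
  obtain k where "r - s = int p ^ n * k" using assms(2) by (elim dvdE)
  then have "r = s + int p ^ n * k" by simp
  then have "of_int r / of_nat p ^ n = (of_int s / of_nat p ^ n + of_int k :: complex)"
    using assms(1) by (simp add: field_simps)
  then have "2 * of_real pi * \<i> * (of_int r / of_nat p ^ n)
      = 2 * of_real pi * \<i> * (of_int s / of_nat p ^ n) + (of_int (2 * k) * of_real pi) * \<i>"
    by (simp add: algebra_simps del: times_divide_eq_right times_divide_eq_left)
  then have "2 * of_real pi * \<i> * of_int r / of_nat p ^ n
      = 2 * of_real pi * \<i> * of_int s / of_nat p ^ n + (of_int (2 * k) * of_real pi) * \<i>"
    by (simp only: times_divide_eq_right)
  then show ?thesis unfolding exp_eq by (intro exI[of _ k]) simp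
qed

text \<open>Frees the character from the least exponent and the arbitrary choice in its definition.
  The chosen numerator at level \<open>n\<close>, scaled by \<open>p ^ (N - n)\<close>, approximates
  \<open>p ^ N * x\<close> modulo \<open>p ^ N\<close> just as \<open>r\<close> does, so the two
  numerators differ by a multiple of \<open>p ^ N\<close>, which the exponential does not
  see.\<close>

lemma padic_char_eq:
  fixes x :: "'p::prime_card padic"
  assumes N: "pnorm (of_int r - of_nat CARD('p) ^ N * x) \<le> inverse (real CARD('p) ^ N)"
  shows "padic_char x = exp (2 * of_real pi * \<i> * of_int r / of_nat CARD('p) ^ N)"
proof -
  let ?P = "of_nat CARD('p) :: 'p padic" and ?R = "real CARD('p)"
  have R: "1 < ?R" by (rule card_gt_1)
  have P0: "?P \<noteq> 0" using R by auto
  define n where "n = (LEAST n. ?P ^ n * x \<in> padic_ints)"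
  define r0 where "r0 = (SOME r::int. \<exists>z\<in>padic_ints. of_int r - ?P ^ n * x = ?P ^ n * z)"
  have "inverse (?R ^ N) \<le> 1" using R by (simp add: inverse_le_1_iff)
  then have "pnorm (of_int r - ?P ^ N * x) \<le> 1" using N by linarith
  then have "?P ^ N * x \<in> padic_ints"
    using pnorm_diff[of "of_int r" "of_int r - ?P ^ N * x"] pnorm_of_int_le_1[of r, where 'p = 'p]
    by (simp add: padic_ints_def)
  then have n: "?P ^ n * x \<in> padic_ints" "n \<le> N"
    unfolding n_def by (auto intro: LeastI Least_le)
  obtain r1 where r1: "pnorm (of_int r1 - ?P ^ n * x) \<le> inverse (?R ^ n)"
    using padic_int_approx[of "?P ^ n * x" n] n(1) by (auto simp: padic_ints_def)
  \<comment> \<open>The integer \<open>r1\<close> witnesses that the choice defining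
    \<open>r0\<close> is made from a nonempty set.\<close>
  have "(of_int r1 - ?P ^ n * x) / ?P ^ n \<in> padic_ints"
    using r1 R by (simp add: padic_ints_def pnorm_divide field_simps)
  moreover have "of_int r1 - ?P ^ n * x = ?P ^ n * ((of_int r1 - ?P ^ n * x) / ?P ^ n)"
    using P0 by simp
  ultimately have "\<exists>r::int. \<exists>z\<in>padic_ints. of_int r - ?P ^ n * x = ?P ^ n * z" by blast
  then have "\<exists>z\<in>padic_ints. of_int r0 - ?P ^ n * x = ?P ^ n * z"
    unfolding r0_def by (rule someI_ex)
  then obtain z where z: "pnorm z \<le> 1" "of_int r0 - ?P ^ n * x = ?P ^ n * z"
    by (auto simp: padic_ints_def)
  have NN: "?P ^ N = ?P ^ (N - n) * ?P ^ n" using n(2) by (simp flip: power_add)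
  have "of_int (r0 * int CARD('p) ^ (N - n)) - ?P ^ N * x = ?P ^ (N - n) * (of_int r0 - ?P ^ n * x)"
    by (simp add: NN algebra_simps)
  also have "\<dots> = ?P ^ N * z" using z by (simp add: NN)
  finally have "pnorm (of_int (r0 * int CARD('p) ^ (N - n)) - ?P ^ N * x) \<le> inverse (?R ^ N)"
    using z(1) R by (simp add: pnorm_mult mult_left_le)
  then have "pnorm (of_int (r0 * int CARD('p) ^ (N - n) - r) :: 'p padic) \<le> inverse (?R ^ N)"
    using pnorm_diff[of "of_int (r0 * int CARD('p) ^ (N - n)) - ?P ^ N * x" "of_int r - ?P ^ N * x"] N
    by simp
  then have dv: "int CARD('p) ^ N dvd r0 * int CARD('p) ^ (N - n) - r"
    by (simp only: pnorm_of_int_le_iff)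
  have "padic_char x = exp (2 * of_real pi * \<i> * of_int r0 / of_nat CARD('p) ^ n)"
    unfolding padic_char_def Let_def n_def[symmetric] r0_def[symmetric] ..
  also have "of_int r0 / of_nat CARD('p) ^ n
      = (of_int (r0 * int CARD('p) ^ (N - n)) / of_nat CARD('p) ^ N :: complex)"
  proof -
    have "(of_nat CARD('p) ^ N :: complex) = of_nat CARD('p) ^ (N - n) * of_nat CARD('p) ^ n"
      using n(2) by (simp flip: power_add)
    then show ?thesis using R by simp
  qed
  then have "2 * of_real pi * \<i> * of_int r0 / of_nat CARD('p) ^ n
      = (2 * of_real pi * \<i> * of_int (r0 * int CARD('p) ^ (N - n)) / of_nat CARD('p) ^ N :: complex)"
    by (simp only: times_divide_eq_right[symmetric])
  also have "exp \<dots> = exp (2 * of_real pi * \<i> * of_int r / of_nat CARD('p) ^ N)"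
    using R dv by (intro exp_padic_eq) auto
  finally show ?thesis .
qed

text \<open>Having approximations at all large levels allows two elements to be treated at a common
  level, which is what additivity of the character needs.\<close>

lemma padic_char_approx:
  fixes x :: "'p::prime_card padic"
  shows "\<exists>N. \<forall>M\<ge>N. \<exists>r::int.
    pnorm (of_int r - of_nat CARD('p) ^ M * x) \<le> inverse (real CARD('p) ^ M)"
proof -
  have R: "1 < real CARD('p)" by (rule card_gt_1)
  obtain N where N: "pnorm x < real CARD('p) ^ N"
    using real_arch_pow[OF R] by blast
  show ?thesis
  proof (intro exI[of _ N] allI impI)
    fix M assume "N \<le> M"
    then have "real CARD('p) ^ N \<le> real CARD('p) ^ M" using R by (intro power_increasing) auto
    then have "pnorm x \<le> real CARD('p) ^ M" using N by linarith
    then have "pnorm (of_nat CARD('p) ^ M * x) \<le> 1"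
      using R by (simp add: pnorm_mult field_simps)
    then show "\<exists>r::int. pnorm (of_int r - of_nat CARD('p) ^ M * x) \<le> inverse (real CARD('p) ^ M)"
      using padic_int_approx by metis
  qed
qed

lemma padic_char_add: "padic_char (x + y) = padic_char x * padic_char y"
  for x y :: "'p::prime_card padic"
proof -
  obtain N1 where N1: "\<And>M. N1 \<le> M \<Longrightarrow>
    \<exists>r::int. pnorm (of_int r - of_nat CARD('p) ^ M * x) \<le> inverse (real CARD('p) ^ M)"
    using padic_char_approx by blast
  obtain N2 where N2: "\<And>M. N2 \<le> M \<Longrightarrow>
    \<exists>r::int. pnorm (of_int r - of_nat CARD('p) ^ M * y) \<le> inverse (real CARD('p) ^ M)"
    using padic_char_approx by blast
  define N where "N = max N1 N2"
  obtain r s where r: "pnorm (of_int r - of_nat CARD('p) ^ N * x) \<le> inverse (real CARD('p) ^ N)"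
    and s: "pnorm (of_int s - of_nat CARD('p) ^ N * y) \<le> inverse (real CARD('p) ^ N)"
    using N1[of N] N2[of N] by (auto simp: N_def)
  have "of_int (r + s) - of_nat CARD('p) ^ N * (x + y)
      = (of_int r - of_nat CARD('p) ^ N * x) + (of_int s - of_nat CARD('p) ^ N * y)"
    by (simp add: algebra_simps)
  then have rs: "pnorm (of_int (r + s) - of_nat CARD('p) ^ N * (x + y)) \<le> inverse (real CARD('p) ^ N)"
    using pnorm_add[of "of_int r - of_nat CARD('p) ^ N * x" "of_int s - of_nat CARD('p) ^ N * y"] r s
    by (simp only: max_def split: if_splits)
  have "2 * of_real pi * \<i> * of_int (r + s) / of_nat CARD('p) ^ N
    = 2 * of_real pi * \<i> * of_int r / of_nat CARD('p) ^ N
      + (2 * of_real pi * \<i> * of_int s / of_nat CARD('p) ^ N :: complex)"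
    by (simp add: algebra_simps add_divide_distrib)
  then show ?thesis
    unfolding padic_char_eq[OF rs] padic_char_eq[OF r] padic_char_eq[OF s]
    by (simp only: exp_add)
qed

lemma padic_char_ints: "pnorm x \<le> 1 \<Longrightarrow> padic_char x = 1" for x :: "'p::prime_card padic"
  using padic_char_eq[of 0 0 x] by simp

lemma padic_char_0 [simp]: "padic_char (0 :: 'p::prime_card padic) = 1"
  by (simp add: padic_char_ints)

lemma padic_char_add_ints:
  "pnorm y \<le> 1 \<Longrightarrow> padic_char (x + y) = padic_char x" for x y :: "'p::prime_card padic"
  by (simp add: padic_char_add padic_char_ints)

lemma norm_padic_char [simp]: "norm (padic_char (x :: 'p::prime_card padic)) = 1"
proof -
  obtain N where "\<And>M. N \<le> M \<Longrightarrow>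
    \<exists>r::int. pnorm (of_int r - of_nat CARD('p) ^ M * x) \<le> inverse (real CARD('p) ^ M)"
    using padic_char_approx by blast
  then obtain r where r: "pnorm (of_int r - of_nat CARD('p) ^ N * x) \<le> inverse (real CARD('p) ^ N)"
    by blast
  have "Re (2 * of_real pi * \<i> * of_int r / of_nat CARD('p) ^ N) = 0"
    by (simp flip: of_nat_power)
  then show ?thesis unfolding padic_char_eq[OF r] norm_exp_eq_Re by simp
qed

lemma padic_char_of_nat_mult: "padic_char (of_nat n * x) = padic_char x ^ n"
  for x :: "'p::prime_card padic"
  by (induction n) (simp_all add: padic_char_add distrib_right)

text \<open>Here \<open>p * x\<close> is a unit and the character is
  \<open>exp (2 pi i r / p)\<close> with \<open>r\<close> congruent to \<open>p * x\<close> modulo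
  \<open>p\<close>. The value 1 would force \<open>p\<close> to divide \<open>r\<close>, hence make
  \<open>p * x\<close> a non-unit.\<close>

lemma padic_char_neq_1:
  fixes x :: "'p::prime_card padic"
  assumes "pnorm x = real CARD('p)"
  shows "padic_char x \<noteq> 1"
proof
  let ?P = "of_nat CARD('p) :: 'p padic" and ?R = "real CARD('p)"
  have R: "1 < ?R" by (rule card_gt_1)
  assume one: "padic_char x = 1"
  have px: "pnorm (?P * x) = 1" using assms R by (simp add: pnorm_mult)
  obtain r where r: "pnorm (of_int r - ?P ^ 1 * x) \<le> inverse (?R ^ 1)"
    using padic_int_approx[of "?P * x" 1] px by auto
  have "exp (2 * of_real pi * \<i> * of_int r / of_nat CARD('p) ^ 1) = exp (0 :: complex)"
    using padic_char_eq[OF r] one by simp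
  then obtain k :: int where
    k: "2 * of_real pi * \<i> * of_int r / of_nat CARD('p) ^ 1
      = 0 + complex_of_real (real_of_int (2 * k) * pi) * \<i>"
    unfolding exp_eq by blast
  have "of_int r = (of_int (k * int CARD('p)) :: complex)" using k R by (simp add: field_simps)
  then have "r = k * int CARD('p)" by (simp only: of_int_eq_iff)
  then have "int CARD('p) ^ 1 dvd r" by simp
  then have "pnorm (of_int r :: 'p padic) \<le> inverse (?R ^ 1)" by (simp only: pnorm_of_int_le_iff)
  then have "pnorm (?P * x) \<le> inverse ?R"
    using r pnorm_diff[of "of_int r" "of_int r - ?P * x"] by simp
  moreover have "inverse ?R < 1" using R by (simp add: inverse_less_1_iff)
  ultimately show False using px by linarith
qed

text \<open>Since \<open>p * x\<close> is integral, \<open>padic_char x\<close> is a p-th root of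
  unity; it differs from 1, so the geometric sum vanishes.\<close>

lemma padic_char_sum_eq_0:
  fixes x :: "'p::prime_card padic"
  assumes "pnorm x = real CARD('p)"
  shows "(\<Sum>t<CARD('p). padic_char (of_nat t * x)) = 0"
proof -
  have "pnorm (of_nat CARD('p) * x) \<le> 1"
    using assms card_gt_1[where 'p = 'p] by (simp add: pnorm_mult)
  then have "padic_char x ^ CARD('p) = 1"
    using padic_char_ints padic_char_of_nat_mult by metis
  then show ?thesis
    using padic_char_neq_1[OF assms] by (simp add: padic_char_of_nat_mult sum_gp_strict)
qed

section \<open>Integration over spheres\<close>

definition padic_sphere :: "nat \<Rightarrow> 'p::prime_card padic set" where
  "padic_sphere n = {x. pnorm x = real CARD('p) ^ n}"

lemma padic_sphere_neq_0: "x \<in> padic_sphere n \<Longrightarrow> x \<noteq> 0"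
  for x :: "'p::prime_card padic"
  using card_gt_1[where 'p = 'p] by (auto simp: padic_sphere_def)

text \<open>Translations by less than the radius preserve the sphere, which makes averaging over
  such translates possible.\<close>

lemma padic_sphere_add_iff:
  fixes x h :: "'p::prime_card padic"
  assumes "pnorm h < real CARD('p) ^ n"
  shows "h + x \<in> padic_sphere n \<longleftrightarrow> x \<in> padic_sphere n"
  using assms pnorm_add_eq_left[of h x] pnorm_add_eq_left[of "- h" "h + x"]
  by (auto simp: padic_sphere_def add.commute)

lemma annulus_eq_UN_padic_sphere:
  "{s. real CARD('p) ^ a \<le> pnorm s \<and> pnorm s \<le> real CARD('p) ^ T}
    = (\<Union>j\<in>{a..T}. padic_sphere j :: 'p::prime_card padic set)" (is "?A = ?B")
proof
  have R: "1 < real CARD('p)" by (rule card_gt_1)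
  show "?A \<subseteq> ?B"
  proof
    fix s :: "'p padic" assume s: "s \<in> ?A"
    have "0 < real CARD('p) ^ a" using R by simp
    also have "\<dots> \<le> pnorm s" using s by simp
    finally have "s \<noteq> 0" by auto
    then obtain k where k: "pnorm s = real CARD('p) powi k" by (rule pnorm_value_group)
    have "real CARD('p) powi int a \<le> real CARD('p) powi k"
      "real CARD('p) powi k \<le> real CARD('p) powi int T"
      using s k by auto
    then have "int a \<le> k" "k \<le> int T"
      using R by (meson not_le power_int_strict_increasing)+
    then show "s \<in> ?B"
      using k by (intro UN_I[of "nat k"]) (auto simp: padic_sphere_def power_int_def)
  qed
  show "?B \<subseteq> ?A"
    using R by (auto simp: padic_sphere_def power_increasing)
qed

lemma disjoint_family_padic_sphere:
  "disjoint_family_on (padic_sphere :: nat \<Rightarrow> 'p::prime_card padic set) I"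
  using card_gt_1[where 'p = 'p]
  by (auto simp: disjoint_family_on_def padic_sphere_def)

section \<open>Haar measure of balls and spheres, translation and integrability\<close>

lemma padic_sphere_borel [measurable]: "padic_sphere n \<in> sets (borel :: 'p::prime_card padic measure)"
proof -
  have "closed {x :: 'p padic. dist x 0 = real CARD('p) ^ n}"
    by (intro closed_Collect_eq continuous_intros)
  then show ?thesis
    by (simp add: padic_sphere_def pnorm_eq_dist)
qed

lemma padic_translate_borel [measurable]:
  "(\<lambda>y. c + y) \<in> borel_measurable borel" for c :: "'p::prime_card padic"
  by (intro borel_measurable_continuous_onI) (auto simp: continuous_on_iff dist_padic_def)

text \<open>The ball is covered by the \<open>p ^ n\<close> translates
  \<open>r / p ^ n + padic_ints\<close> with \<open>0 <= r < p ^ n\<close>, and each of them has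
  measure 1.\<close>

lemma padic_haar_ball_le:
  fixes M :: "'p::prime_card padic measure"
  assumes "padic_haar M"
  shows "emeasure M {x. pnorm x \<le> real CARD('p) ^ n} \<le> ennreal (real CARD('p) ^ n)"
proof -
  let ?P = "of_nat CARD('p) :: 'p padic" and ?R = "real CARD('p)"
  have R: "1 < ?R" by (rule card_gt_1)
  have P0: "?P \<noteq> 0" using R by auto
  let ?C = "\<lambda>r. (\<lambda>y. of_nat r / ?P ^ n + y) ` padic_ints"
  have C: "?C r = cball (of_nat r / ?P ^ n) 1" for r
  proof (intro equalityI subsetI)
    fix x assume "x \<in> cball (of_nat r / ?P ^ n) 1"
    then have "x - of_nat r / ?P ^ n \<in> padic_ints"
      by (simp add: padic_ints_def dist_padic_def pnorm_diff_commute)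
    then show "x \<in> ?C r" by (intro image_eqI[of _ _ "x - of_nat r / ?P ^ n"]) auto
  qed (auto simp: padic_ints_def dist_padic_def)
  have "{x. pnorm x \<le> ?R ^ n} \<subseteq> (\<Union>r<CARD('p) ^ n. ?C r)"
  proof
    fix x :: "'p padic" assume "x \<in> {x. pnorm x \<le> ?R ^ n}"
    then have "pnorm (?P ^ n * x) \<le> 1" using R by (simp add: pnorm_mult field_simps)
    then obtain r where r: "pnorm (of_int r - ?P ^ n * x) \<le> inverse (?R ^ n)"
      using padic_int_approx[where n = n] by metis
    \<comment> \<open>Reduction modulo \<open>p ^ n\<close> brings the approximating integer into
      the finite index range without spoiling the approximation.\<close>
    define r' where "r' = nat (r mod int CARD('p) ^ n)"
    have pos: "int CARD('p) ^ n > 0" using R by simp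
    then have r': "int r' = r mod int CARD('p) ^ n" by (simp add: r'_def)
    have "int r' < int CARD('p) ^ n" using pos r' by simp
    then have less: "r' < CARD('p) ^ n" by (simp flip: of_nat_power)
    have "int CARD('p) ^ n dvd int r' - r" unfolding r' by (simp flip: mod_eq_dvd_iff)
    then have "pnorm (of_int (int r' - r) :: 'p padic) \<le> inverse (?R ^ n)"
      by (simp only: pnorm_of_int_le_iff)
    then have "pnorm (of_nat r' - ?P ^ n * x) \<le> inverse (?R ^ n)"
      using r pnorm_add[of "of_int (int r' - r)" "of_int r - ?P ^ n * x"] by simp
    moreover have "of_nat r' / ?P ^ n - x = (of_nat r' - ?P ^ n * x) / ?P ^ n"
      using P0 by (simp add: field_simps)
    ultimately have "x \<in> cball (of_nat r' / ?P ^ n) 1"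
      using R by (simp add: dist_padic_def pnorm_divide field_simps)
    then show "x \<in> (\<Union>r<CARD('p) ^ n. ?C r)" using less C by blast
  qed
  moreover have Cs: "?C r \<in> sets M" for r
    using assms unfolding C by (simp add: padic_haar_def)
  ultimately have "emeasure M {x. pnorm x \<le> ?R ^ n} \<le> emeasure M (\<Union>r<CARD('p) ^ n. ?C r)"
    by (intro emeasure_mono sets.finite_UN) auto
  also have "\<dots> \<le> (\<Sum>r<CARD('p) ^ n. emeasure M (?C r))"
    using Cs by (intro emeasure_subadditive_finite) auto
  also have "\<dots> = (\<Sum>r<CARD('p) ^ n. 1)"
  proof (rule sum.cong[OF refl])
    fix r
    have "(padic_ints :: 'p padic set) = cball 0 1"
      by (auto simp: padic_ints_def dist_padic_def)
    then have "(padic_ints :: 'p padic set) \<in> sets borel" by (metis borel_closed closed_cball)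
    then show "emeasure M (?C r) = 1" using assms unfolding padic_haar_def by metis
  qed
  also have "\<dots> = ennreal (?R ^ n)" by (simp add: ennreal_of_nat_eq_real_of_nat)
  finally show ?thesis .
qed

lemma padic_haar_sphere_le:
  fixes M :: "'p::prime_card padic measure"
  assumes "padic_haar M"
  shows "emeasure M (padic_sphere n) \<le> ennreal (real CARD('p) ^ n)"
proof -
  have "{x :: 'p padic. pnorm x \<le> real CARD('p) ^ n} = cball 0 (real CARD('p) ^ n)"
    by (auto simp: dist_padic_def)
  then have "{x :: 'p padic. pnorm x \<le> real CARD('p) ^ n} \<in> sets M"
    using assms by (simp add: padic_haar_def)
  then have "emeasure M (padic_sphere n) \<le> emeasure M {x. pnorm x \<le> real CARD('p) ^ n}"
    by (intro emeasure_mono) (auto simp: padic_sphere_def)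
  then show ?thesis using padic_haar_ball_le[OF assms, of n] by (rule order_trans)
qed

lemma padic_haar_sets [simp]: "padic_haar M \<Longrightarrow> sets M = sets borel"
  by (simp add: padic_haar_def)

lemma padic_haar_integral_translate:
  fixes M :: "'p::prime_card padic measure" and f :: "'p padic \<Rightarrow> real"
  assumes M: "padic_haar M" and f: "f \<in> borel_measurable borel"
  shows "(\<integral>x. f (c + x) \<partial>M) = (\<integral>x. f x \<partial>M)"
proof -
  have t: "(\<lambda>y. c + y) \<in> measurable M borel"
    using padic_translate_borel[of c] M by (simp cong: measurable_cong_sets)
  have "distr M borel (\<lambda>y. c + y) = M"
  proof (rule measure_eqI)
    fix A assume "A \<in> sets (distr M borel (\<lambda>y. c + y))"
    then have A: "A \<in> sets borel" by simp
    \<comment> \<open>Invariance in \<open>padic_haar\<close> is stated for images, so the preimage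
      is rewritten as an image under the inverse translation.\<close>
    have "(\<lambda>y. c + y) -` A \<inter> space M = (\<lambda>y. - c + y) ` A"
    proof (intro equalityI subsetI)
      fix x assume "x \<in> (\<lambda>y. c + y) -` A \<inter> space M"
      then show "x \<in> (\<lambda>y. - c + y) ` A"
        by (intro image_eqI[of _ _ "c + x"]) auto
    qed (use sets_eq_imp_space_eq[OF padic_haar_sets[OF M]] in auto)
    moreover have "emeasure M ((\<lambda>y. - c + y) ` A) = emeasure M A"
      using A M unfolding padic_haar_def by blast
    ultimately show "emeasure (distr M borel (\<lambda>y. c + y)) A = emeasure M A"
      using emeasure_distr[OF t A] by argo
  qed (use M in simp)
  then show ?thesis using integral_distr[OF t f] by simp
qed

lemma padic_haar_set_integrable_bounded:
  fixes M :: "'p::prime_card padic measure" and f :: "'p padic \<Rightarrow> real"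
  assumes "padic_haar M" "f \<in> borel_measurable borel"
    and "\<And>x. x \<in> padic_sphere n \<Longrightarrow> \<bar>f x\<bar> \<le> B"
  shows "set_integrable M (padic_sphere n) f"
  unfolding set_integrable_def
proof (rule integrableI_bounded_set_indicator[where B = B])
  show "emeasure M (padic_sphere n) < \<infinity>"
    using padic_haar_sphere_le[OF assms(1), of n] by (simp add: le_less_trans)
qed (use assms in \<open>auto cong: measurable_cong_sets\<close>)

section \<open>Polynomial phases\<close>

lemma poly_eq_sum_atMost:
  fixes g :: "'a::comm_semiring_1 poly"
  assumes "Polynomial.degree g \<le> D"
  shows "poly g x = (\<Sum>l\<le>D. Polynomial.coeff g l * x ^ l)"
  unfolding poly_altdef using assms
  by (intro sum.mono_neutral_left) (auto simp: coeff_eq_0)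

section \<open>Local constancy of the phase, and its first-order expansion\<close>

lemma pnorm_power_diff_le:
  fixes x y :: "'p::prime_card padic"
  assumes "pnorm x \<le> B" "pnorm y \<le> B" "1 \<le> B"
  shows "pnorm (x ^ l - y ^ l) \<le> pnorm (x - y) * B ^ l"
proof (induction l)
  case (Suc l)
  have eq: "x ^ Suc l - y ^ Suc l = x * (x ^ l - y ^ l) + (x - y) * y ^ l"
    by (simp add: algebra_simps)
  have 1: "pnorm (x * (x ^ l - y ^ l)) \<le> pnorm (x - y) * B ^ Suc l"
    using mult_mono[OF assms(1) Suc] assms(3) by (simp add: pnorm_mult mult_ac)
  have 2: "pnorm ((x - y) * y ^ l) \<le> pnorm (x - y) * B ^ Suc l"
  proof -
    have "pnorm y ^ l \<le> B ^ l" using assms by (intro power_mono) auto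
    also have "\<dots> \<le> B ^ Suc l" using assms by (intro power_increasing) auto
    finally show ?thesis by (auto simp: pnorm_mult pnorm_power intro: mult_left_mono)
  qed
  show ?case unfolding eq using 1 2 by (intro order_trans[OF pnorm_add max.boundedI])
qed simp

text \<open>Near \<open>x\<close> the polynomial is Lipschitz with constant \<open>K\<close>, so
  within distance \<open>1 / K\<close> its value changes by a p-adic integer, on which the character
  is trivial. Continuity and Borel measurability follow.\<close>

lemma padic_char_poly_locally_constant:
  fixes g :: "'p::prime_card padic poly"
  shows "\<exists>d>0. \<forall>y. dist y x < d \<longrightarrow> padic_char (poly g y) = padic_char (poly g x)"
proof -
  define B where "B = max 1 (pnorm x)"
  define D where "D = Polynomial.degree g"
  \<comment> \<open>The summand 1 gives \<open>K >= 1\<close>, so that points within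
    \<open>1 / K\<close> of \<open>x\<close> also have absolute value at most
    \<open>B\<close>.\<close>
  define K where "K = 1 + (\<Sum>l\<le>D. pnorm (Polynomial.coeff g l) * B ^ l)"
  have B: "1 \<le> B" "pnorm x \<le> B" by (auto simp: B_def)
  have K: "1 \<le> K" using B by (auto simp: K_def intro!: sum_nonneg)
  have "padic_char (poly g y) = padic_char (poly g x)" if y: "dist y x < inverse K" for y
  proof -
    have yx: "pnorm (y - x) < inverse K" using y by (simp add: dist_padic_def)
    have "inverse K \<le> 1" using K by (simp add: inverse_le_1_iff)
    then have "pnorm y \<le> B"
      using pnorm_add[of "y - x" x] yx B by simp
    have "pnorm (poly g y - poly g x) \<le> 1"
    proof -
      have "poly g y - poly g x = (\<Sum>l\<le>D. Polynomial.coeff g l * (y ^ l - x ^ l))"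
        by (simp add: poly_altdef D_def right_diff_distrib sum_subtractf)
      moreover have "pnorm (\<Sum>l\<le>D. Polynomial.coeff g l * (y ^ l - x ^ l)) \<le> 1"
      proof (rule pnorm_sum_le)
        fix l assume l: "l \<in> {..D}"
        have "pnorm (Polynomial.coeff g l * (y ^ l - x ^ l))
            \<le> pnorm (Polynomial.coeff g l) * (pnorm (y - x) * B ^ l)"
          using pnorm_power_diff_le[OF \<open>pnorm y \<le> B\<close> B(2,1), of l]
          by (auto simp: pnorm_mult intro: mult_left_mono)
        also have "\<dots> = pnorm (y - x) * (pnorm (Polynomial.coeff g l) * B ^ l)" by simp
        also have "\<dots> \<le> inverse K * K"
        proof (rule mult_mono)
          have "pnorm (Polynomial.coeff g l) * B ^ l
              \<le> (\<Sum>l\<le>D. pnorm (Polynomial.coeff g l) * B ^ l)"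
            using l B by (intro member_le_sum) auto
          then show "pnorm (Polynomial.coeff g l) * B ^ l \<le> K" by (simp add: K_def)
        qed (use yx B K in auto)
        finally show "pnorm (Polynomial.coeff g l * (y ^ l - x ^ l)) \<le> 1" using K by simp
      qed simp
      ultimately show ?thesis by simp
    qed
    then show ?thesis using padic_char_add_ints[of "poly g y - poly g x" "poly g x"] by simp
  qed
  moreover have "0 < inverse K" using K by simp
  ultimately show ?thesis by blast
qed

lemma padic_char_poly_borel [measurable]:
  "(\<lambda>x. padic_char (poly g x)) \<in> borel_measurable borel" for g :: "'p::prime_card padic poly"
proof (rule borel_measurable_continuous_onI)
  show "continuous_on UNIV (\<lambda>x. padic_char (poly g x))"
    unfolding continuous_on_iff
    using padic_char_poly_locally_constant[of _ g] by (metis dist_self)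
qed

text \<open>Passing from \<open>l\<close> to \<open>l + 1\<close> multiplies the remainder by
  \<open>1 + q\<close> and adds \<open>l * q ^ 2\<close>; both \<open>1 + q\<close> and the integer
  \<open>l\<close> have absolute value at most 1.\<close>

lemma pnorm_binomial_remainder_le:
  fixes q :: "'p::prime_card padic"
  assumes "pnorm q \<le> 1"
  shows "pnorm ((1 + q) ^ l - 1 - of_nat l * q) \<le> pnorm q ^ 2"
proof (induction l)
  case (Suc l)
  have "(1 + q) ^ Suc l - 1 - of_nat (Suc l) * q
      = (1 + q) * ((1 + q) ^ l - 1 - of_nat l * q) + of_nat l * q ^ 2"
    by (simp add: algebra_simps power2_eq_square)
  moreover have "pnorm ((1 + q) * ((1 + q) ^ l - 1 - of_nat l * q)) \<le> 1 * pnorm q ^ 2"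
    unfolding pnorm_mult using pnorm_add[of 1 q] assms by (intro mult_mono Suc) auto
  moreover have "pnorm (of_nat l * q ^ 2) \<le> 1 * pnorm q ^ 2"
    unfolding pnorm_mult pnorm_power by (intro mult_right_mono pnorm_of_nat_le_1) auto
  ultimately show ?case
    using pnorm_add[of "(1 + q) * ((1 + q) ^ l - 1 - of_nat l * q)" "of_nat l * q ^ 2"] by simp
qed simp

text \<open>With the displacement written multiplicatively as \<open>s * (1 + q)\<close>, the linear
  term is \<open>s g'(s) * q\<close>, and one bound \<open>B\<close> on the nonconstant terms of
  \<open>g\<close> controls the whole remainder.\<close>

lemma pnorm_poly_remainder_le:
  fixes g :: "'p::prime_card padic poly"
  assumes deg: "Polynomial.degree g \<le> D" and q: "pnorm q \<le> 1" and "0 \<le> B"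
    and B: "\<And>l. l \<in> {1..D} \<Longrightarrow> pnorm (Polynomial.coeff g l) * pnorm s ^ l \<le> B"
  shows "pnorm (poly g (s * (1 + q)) - poly g s
    - (\<Sum>l=1..D. of_nat l * Polynomial.coeff g l * s ^ l) * q) \<le> B * pnorm q ^ 2"
proof -
  have E: "(\<Sum>l=1..D. of_nat l * Polynomial.coeff g l * s ^ l)
      = (\<Sum>l\<le>D. of_nat l * Polynomial.coeff g l * s ^ l)"
    by (intro sum.mono_neutral_left) (auto simp: not_le)
  have "poly g (s * (1 + q)) - poly g s
      - (\<Sum>l=1..D. of_nat l * Polynomial.coeff g l * s ^ l) * q
    = (\<Sum>l\<le>D. Polynomial.coeff g l * s ^ l * ((1 + q) ^ l - 1 - of_nat l * q))"
    unfolding E poly_eq_sum_atMost[OF deg] sum_distrib_right sum_subtractf[symmetric]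
      power_mult_distrib
    by (intro sum.cong) (auto simp: algebra_simps)
  also have "pnorm \<dots> \<le> B * pnorm q ^ 2"
  proof (rule pnorm_sum_le)
    fix l assume l: "l \<in> {..D}"
    show "pnorm (Polynomial.coeff g l * s ^ l * ((1 + q) ^ l - 1 - of_nat l * q)) \<le> B * pnorm q ^ 2"
    proof (cases "l = 0")
      case False
      then have "pnorm (Polynomial.coeff g l * s ^ l) \<le> B"
        using B[of l] l by (simp add: pnorm_mult pnorm_power)
      then show ?thesis
        unfolding pnorm_mult[of "Polynomial.coeff g l * s ^ l"]
        using pnorm_binomial_remainder_le[OF q] \<open>0 \<le> B\<close> by (intro mult_mono) auto
    qed (use \<open>0 \<le> B\<close> in simp)
  qed (use \<open>0 \<le> B\<close> in simp)
  finally show ?thesis .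
qed

text \<open>Averaging over the translates \<open>s + t h\<close> with \<open>t < p\<close>: on each of them the phase is linear
  in \<open>t\<close> modulo integers, with slope of absolute value \<open>p\<close>.\<close>

lemma padic_sphere_integral_eq_0:
  fixes M :: "'p::prime_card padic measure" and g :: "'p padic poly"
  assumes M: "padic_haar M" and deg: "Polynomial.degree g \<le> D"
    and B: "\<And>l. l \<in> {1..D} \<Longrightarrow> pnorm (Polynomial.coeff g l) * (real CARD('p) ^ j) ^ l \<le> B"
    and k: "k \<in> {1..D}"
    and W: "W = pnorm (of_nat k * Polynomial.coeff g k) * (real CARD('p) ^ j) ^ k"
    and dom: "\<And>l. l \<in> {1..D} \<Longrightarrow> l \<noteq> k \<Longrightarrow>
      pnorm (of_nat l * Polynomial.coeff g l) * (real CARD('p) ^ j) ^ l < W"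
    and WB: "real CARD('p) < W" "real CARD('p) ^ 2 * B \<le> W ^ 2"
  shows "(LINT s : padic_sphere j | M. Re (padic_char (poly g s))) = 0"
proof -
  let ?P = "of_nat CARD('p) :: 'p padic" and ?R = "real CARD('p)"
  let ?S = "padic_sphere j :: 'p padic set"
  let ?\<psi> = "\<lambda>s. padic_char (poly g s)"
  \<comment> \<open>This is \<open>s g'(s)\<close>. Its \<open>k\<close>-th term dominates strictly
    on the sphere, so its absolute value is \<open>W\<close> there.\<close>
  define E where "E s = (\<Sum>l=1..D. of_nat l * Polynomial.coeff g l * s ^ l)" for s
  \<comment> \<open>The point \<open>s1\<close> lies on the sphere, and \<open>h\<close> is chosen
    so that \<open>E s1 * (h / s1) = 1 / p\<close>. As \<open>E s\<close> and \<open>s\<close> have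
    constant absolute value on the sphere, \<open>E s * (h / s)\<close> has absolute value
    \<open>p\<close> for every \<open>s\<close> in it.\<close>
  define s1 where "s1 = inverse (?P ^ j)"
  define h where "h = s1 / (?P * E s1)"
  have R: "1 < ?R" by (rule card_gt_1)
  have B0: "0 \<le> B"
    using B[OF k] by (rule order_trans[rotated]) (use R in auto)
  have E: "pnorm (E s) = W" if "s \<in> ?S" for s
  proof -
    have s: "pnorm s = ?R ^ j" using that by (simp add: padic_sphere_def)
    have "pnorm (E s) = pnorm (of_nat k * Polynomial.coeff g k * s ^ k)"
      unfolding E_def
    proof (rule pnorm_sum_dominant)
      show "0 < pnorm (of_nat k * Polynomial.coeff g k * s ^ k)"
        using WB R unfolding W by (simp add: pnorm_mult pnorm_power s)
    next
      fix l assume "l \<in> {1..D}" "l \<noteq> k"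
      from dom[OF this] show "pnorm (of_nat l * Polynomial.coeff g l * s ^ l)
          < pnorm (of_nat k * Polynomial.coeff g k * s ^ k)"
        unfolding W by (simp add: pnorm_mult pnorm_power s)
    qed (use k in auto)
    then show ?thesis unfolding W by (simp add: pnorm_mult pnorm_power s)
  qed
  have s1: "s1 \<in> ?S" by (simp add: padic_sphere_def s1_def pnorm_inverse)
  have h: "pnorm h = ?R ^ j * (?R / W)"
    using E[OF s1] s1 R by (simp add: h_def pnorm_divide pnorm_mult padic_sphere_def divide_inverse
        pnorm_inverse)
  have RW: "0 < ?R / W" "?R / W < 1" using WB R by auto
  then have "?R ^ j * (?R / W) < ?R ^ j * 1"
    using R by (intro mult_strict_left_mono) auto
  then have "pnorm h < ?R ^ j" using h by simp
  moreover have "pnorm (of_nat t * h) \<le> pnorm h" for t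
    using mult_right_mono[OF pnorm_of_nat_le_1[of t] pnorm_nonneg[of h]]
    by (simp add: pnorm_mult)
  ultimately have hlt: "pnorm (of_nat t * h) < ?R ^ j" for t
    by (rule le_less_trans[rotated])
  have pointwise: "(\<Sum>t<CARD('p). ?\<psi> (of_nat t * h + s)) = 0" if s: "s \<in> ?S" for s
  proof -
    have s0: "s \<noteq> 0" using padic_sphere_neq_0[OF s] .
    have ns: "pnorm s = ?R ^ j" using s by (simp add: padic_sphere_def)
    define u where "u = E s * (h / s)"
    have "pnorm (h / s) = ?R / W" using h ns R by (simp add: pnorm_divide)
    then have u: "pnorm u = ?R" using E[OF s] RW WB(1) R unfolding u_def pnorm_mult by simp
    have "?\<psi> (of_nat t * h + s) = ?\<psi> s * padic_char (of_nat t * u)" for t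
    proof -
      define q where "q = of_nat t * h / s"
      have "pnorm q \<le> pnorm (h / s)"
        using mult_right_mono[OF pnorm_of_nat_le_1[of t] pnorm_nonneg[of "h / s"]]
        by (simp add: q_def pnorm_mult pnorm_divide)
      then have q: "pnorm q \<le> ?R / W" using \<open>pnorm (h / s) = ?R / W\<close> by simp
      \<comment> \<open>The hypothesis \<open>p ^ 2 * B <= W ^ 2\<close> makes the second-order
        remainder integral, hence invisible to the character.\<close>
      have "B * pnorm q ^ 2 \<le> B * (?R / W) ^ 2"
        using q B0 by (intro mult_left_mono power_mono) auto
      also have "\<dots> \<le> 1" using WB R by (simp add: field_simps)
      finally have Bq: "B * pnorm q ^ 2 \<le> 1" .
      have "pnorm (poly g (s * (1 + q)) - poly g s - E s * q) \<le> B * pnorm q ^ 2"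
        unfolding E_def using q RW B0 B deg by (intro pnorm_poly_remainder_le) (auto simp: ns)
      then have "pnorm (poly g (s * (1 + q)) - poly g s - E s * q) \<le> 1" using Bq by linarith
      moreover have "s * (1 + q) = of_nat t * h + s" using s0 by (simp add: q_def field_simps)
      moreover have "E s * q = of_nat t * u" by (simp add: q_def u_def)
      ultimately have "pnorm (poly g (of_nat t * h + s) - poly g s - of_nat t * u) \<le> 1" by simp
      from padic_char_add_ints[OF this, of "poly g s + of_nat t * u"]
      show ?thesis by (simp add: padic_char_add)
    qed
    then show ?thesis
      using padic_char_sum_eq_0[OF u] by (simp flip: sum_distrib_left)
  qed
  have meas: "(\<lambda>s. Re (?\<psi> (c + s))) \<in> borel_measurable borel" for c
    using measurable_compose[OF padic_translate_borel[of c] padic_char_poly_borel[of g]] by simp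
  have int: "set_integrable M ?S (\<lambda>s. Re (?\<psi> (c + s)))" for c
    using M meas by (rule padic_haar_set_integrable_bounded[where B = 1])
      (use abs_Re_le_cmod[of "?\<psi> (c + _)"] in simp)
  have meas0: "(\<lambda>s. indicator ?S s * Re (?\<psi> s)) \<in> borel_measurable borel"
    using meas[of 0] by simp
  have transl: "(LINT s : ?S | M. Re (?\<psi> (of_nat t * h + s))) = (LINT s : ?S | M. Re (?\<psi> s))" for t
  proof -
    have "indicator ?S (of_nat t * h + s) = (indicator ?S s :: real)" for s
      using padic_sphere_add_iff[OF hlt, of t s] by (simp add: indicator_def)
    then show ?thesis
      using padic_haar_integral_translate[OF M meas0, of "of_nat t * h"]
      by (simp add: set_lebesgue_integral_def)
  qed
  have "?R * (LINT s : ?S | M. Re (?\<psi> s))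
      = (\<Sum>t<CARD('p). LINT s : ?S | M. Re (?\<psi> (of_nat t * h + s)))"
    by (simp add: transl)
  also have "\<dots> = (\<Sum>t<CARD('p). \<integral>s. indicator ?S s * Re (?\<psi> (of_nat t * h + s)) \<partial>M)"
    by (simp add: set_lebesgue_integral_def)
  also have "\<dots> = (\<integral>s. (\<Sum>t<CARD('p). indicator ?S s * Re (?\<psi> (of_nat t * h + s))) \<partial>M)"
    using int by (intro Bochner_Integration.integral_sum[symmetric]) (simp add: set_integrable_def)
  also have "\<dots> = (\<integral>s. 0 \<partial>M)"
  proof (rule Bochner_Integration.integral_cong[OF refl])
    fix s
    show "(\<Sum>t<CARD('p). indicator ?S s * Re (?\<psi> (of_nat t * h + s))) = 0"
      using arg_cong[OF pointwise[of s], of Re]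
      by (cases "s \<in> ?S") (auto simp flip: sum_distrib_left)
  qed
  finally show ?thesis using R by simp
qed

section \<open>Counting exceptional spheres\<close>

text \<open>Counting from the least index \<open>m\<close> in \<open>J\<close>, where
  \<open>F m > 1\<close>, the growth gives \<open>F j >= R ^ N\<close> once
  \<open>j >= m + N\<close>. So \<open>J\<close> lies in a window of length
  \<open>N\<close>.\<close>

lemma card_geometric_range_le:
  fixes F :: "nat \<Rightarrow> real"
  assumes "1 < R" and step: "\<And>i j. i \<le> j \<Longrightarrow> F i * R ^ (j - i) \<le> F j"
    and "finite J" and J: "\<And>j. j \<in> J \<Longrightarrow> 1 < F j \<and> F j < R ^ N"
  shows "card J \<le> N"
proof (cases "J = {}")
  case False
  define m where "m = Min J"
  have m: "m \<in> J" "\<And>j. j \<in> J \<Longrightarrow> m \<le> j"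
    using False assms(3) by (auto simp: m_def)
  have "J \<subseteq> {m..<m + N}"
  proof
    fix j assume j: "j \<in> J"
    have "1 * R ^ (j - m) \<le> F m * R ^ (j - m)"
      using J[OF m(1)] \<open>1 < R\<close> by (intro mult_right_mono) auto
    also have "\<dots> \<le> F j" using m(2)[OF j] by (rule step)
    also have "\<dots> < R ^ N" using J[OF j] by simp
    finally have "j - m < N" using \<open>1 < R\<close> by simp
    then show "j \<in> {m..<m + N}" using m(2)[OF j] by auto
  qed
  then show ?thesis using card_mono[of "{m..<m + N}" J] by simp
qed simp

text \<open>On a logarithmic scale the terms \<open>w k * (R ^ j) ^ k\<close> are lines in \<open>j\<close> with
  distinct slopes \<open>k\<close>. Ties occur at the corners of their upper envelope, and the largest slope
  attaining the envelope strictly increases from one corner to the next.\<close>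

lemma card_corners_le:
  fixes w :: "nat \<Rightarrow> real"
  assumes R: "1 < R" and "finite J"
    and J: "\<And>j. j \<in> J \<Longrightarrow> \<exists>k l. k < l \<and> k \<in> {1..D} \<and> l \<in> {1..D} \<and> 0 < w l
      \<and> w k * (R ^ j) ^ k = w l * (R ^ j) ^ l
      \<and> (\<forall>i\<in>{1..D}. w i * (R ^ j) ^ i \<le> w l * (R ^ j) ^ l)"
  shows "card J \<le> D"
proof -
  obtain k l where kl: "\<And>j. j \<in> J \<Longrightarrow> k j < l j \<and> k j \<in> {1..D} \<and> l j \<in> {1..D} \<and> 0 < w (l j)
      \<and> w (k j) * (R ^ j) ^ k j = w (l j) * (R ^ j) ^ l j
      \<and> (\<forall>i\<in>{1..D}. w i * (R ^ j) ^ i \<le> w (l j) * (R ^ j) ^ l j)"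
    using J by metis
  have less: "l i < l j" if ij: "i \<in> J" "j \<in> J" "i < j" for i j
  proof (rule ccontr)
    assume "\<not> l i < l j"
    \<comment> \<open>The term of slope \<open>l i\<close> is maximal at \<open>i\<close> and grows
      strictly faster than the term of slope \<open>k j\<close>. At \<open>j\<close> it would
      therefore exceed the latter, which is maximal there by the tie.\<close>
    then have "k j < l i" using kl[OF ij(2)] by linarith
    let ?Q = "R ^ (j - i)"
    have Rj: "R ^ j = R ^ i * ?Q" using ij(3) by (simp flip: power_add)
    have Q: "1 < ?Q" using R ij(3) by (simp add: one_less_power)
    have pos: "0 < w (l i) * (R ^ i) ^ l i" using kl[OF ij(1)] R by simp
    have "w (k j) * (R ^ j) ^ k j = (w (k j) * (R ^ i) ^ k j) * ?Q ^ k j"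
      by (simp add: Rj power_mult_distrib)
    also have "\<dots> \<le> (w (l i) * (R ^ i) ^ l i) * ?Q ^ k j"
      using kl[OF ij(1)] kl[OF ij(2)] Q by (intro mult_right_mono) auto
    also have "\<dots> < (w (l i) * (R ^ i) ^ l i) * ?Q ^ l i"
      using pos Q \<open>k j < l i\<close> by (intro mult_strict_left_mono power_strict_increasing) auto
    also have "\<dots> = w (l i) * (R ^ j) ^ l i" by (simp add: Rj power_mult_distrib)
    also have "\<dots> \<le> w (l j) * (R ^ j) ^ l j" using kl[OF ij(1)] kl[OF ij(2)] by blast
    also have "\<dots> = w (k j) * (R ^ j) ^ k j" using kl[OF ij(2)] by simp
    finally show False by simp
  qed
  have "inj_on l J"
    by (rule inj_onI) (metis less less_irrefl linorder_neqE_nat)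
  moreover have "l ` J \<subseteq> {1..D}" using kl by blast
  ultimately show ?thesis using card_inj_on_le[of l J "{1..D}"] by simp
qed

section \<open>Lower bounds for single spheres and for their sum\<close>

lemma padic_sphere_char_integral_ge:
  fixes M :: "'p::prime_card padic measure"
  assumes M: "padic_haar M"
  shows "- (real CARD('p) ^ j) \<le> (LINT s : padic_sphere j | M. Re (padic_char (poly g s)))"
proof -
  let ?S = "padic_sphere j :: 'p padic set"
  have S: "?S \<in> sets M" using M by simp
  have "Re (padic_char (poly g s)) \<ge> - 1" for s
    using abs_Re_le_cmod[of "padic_char (poly g s)"] by simp
  moreover have "set_integrable M ?S (\<lambda>s. Re (padic_char (poly g s)))"
    using M by (rule padic_haar_set_integrable_bounded[where B = 1])
      (use abs_Re_le_cmod[of "padic_char (poly g _)"] in auto)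
  moreover have "set_integrable M ?S (\<lambda>s. - 1 :: real)"
    using M by (rule padic_haar_set_integrable_bounded[where B = 1]) auto
  ultimately have "(LINT s : ?S | M. - 1 :: real) \<le> (LINT s : ?S | M. Re (padic_char (poly g s)))"
    by (intro set_integral_mono) auto
  moreover have "(LINT s : ?S | M. - 1 :: real) = - measure M ?S"
    using S by (simp add: set_lebesgue_integral_def sets.Int_space_eq2)
  moreover have "measure M ?S \<le> real CARD('p) ^ j"
    unfolding measure_def using padic_haar_sphere_le[OF M, of j] by (intro enn2real_leI) auto
  ultimately show ?thesis by linarith
qed

lemma padic_sphere_integral_nonneg:
  fixes M :: "'p::prime_card padic measure"
  assumes deg: "Polynomial.degree g \<le> D"
    and B: "\<And>l. l \<in> {..D} \<Longrightarrow> pnorm (Polynomial.coeff g l) * (real CARD('p) ^ j) ^ l \<le> 1"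
  shows "0 \<le> (LINT s : padic_sphere j | M. Re (padic_char (poly g s)))"
proof -
  have "0 \<le> indicator (padic_sphere j) s *\<^sub>R Re (padic_char (poly g s))" for s
  proof (cases "s \<in> padic_sphere j")
    case True
    have "pnorm (poly g s) \<le> 1"
      unfolding poly_eq_sum_atMost[OF deg]
      using B True by (intro pnorm_sum_le) (auto simp: pnorm_mult pnorm_power padic_sphere_def)
    then show ?thesis by (simp add: padic_char_ints)
  qed simp
  then show ?thesis unfolding set_lebesgue_integral_def by (intro Bochner_Integration.integral_nonneg)
qed

text \<open>The hypothesis on \<open>k0\<close> is the form in which the condition on
  \<open>Ess\<close> enters: for \<open>j >= a\<close> the constant coefficient is bounded by a
  nonconstant term. Dividing by \<open>p ^ j\<close> makes each sphere cost at most 1.\<close>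

lemma padic_sphere_integral_sum_ge:
  fixes M :: "'p::prime_card padic measure" and g :: "'p padic poly"
  assumes M: "padic_haar M" and D: "Polynomial.degree g \<le> D" "1 \<le> D"
    and k0: "k0 \<in> {1..D}"
      "pnorm (Polynomial.coeff g 0) \<le> pnorm (Polynomial.coeff g k0) * (real CARD('p) ^ a) ^ k0"
  shows "- real (3 * D + 2) \<le> (\<Sum>j=a..T. (LINT s : padic_sphere j | M. Re (padic_char (poly g s)))
    / real CARD('p) ^ j)"
proof -
  let ?R = "real CARD('p)" and ?c = "\<lambda>l. pnorm (Polynomial.coeff g l)"
  let ?w = "\<lambda>l. pnorm (of_nat l * Polynomial.coeff g l)"
  let ?I = "\<lambda>j. (LINT s : padic_sphere j | M. Re (padic_char (poly g s))) / ?R ^ j"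
  have R: "1 < ?R" by (rule card_gt_1)
  define F where "F j = Max ((\<lambda>l. ?c l * (?R ^ j) ^ l) ` {1..D})" for j
  \<comment> \<open>From \<open>F j >= p ^ N\<close> and \<open>F j <= p ^ D * W\<close> this
    exponent yields both \<open>W >= p ^ (D + 2) > p\<close> and
    \<open>p ^ 2 * F j <= W ^ 2\<close>, the two conditions for the integral to vanish.\<close>
  define N where "N = 2 * D + 2"
  have Fge: "?c l * (?R ^ j) ^ l \<le> F j" if "l \<in> {1..D}" for l j
    unfolding F_def using that by (intro Max_ge) auto
  have Fex: "\<exists>l\<in>{1..D}. F j = ?c l * (?R ^ j) ^ l" for j
  proof -
    have "F j \<in> (\<lambda>l. ?c l * (?R ^ j) ^ l) ` {1..D}"
      unfolding F_def using D(2) by (intro Max_in) auto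
    then show ?thesis by blast
  qed
  define J1 where "J1 = {j\<in>{a..T}. 1 < F j \<and> F j < ?R ^ N}"
  \<comment> \<open>The spheres on which the largest term of \<open>s g'(s)\<close> is attained in
    two degrees; the weights carry the factor \<open>l\<close>, unlike those in
    \<open>F\<close>.\<close>
  define J2 where "J2 = {j\<in>{a..T}. \<exists>k l. k < l \<and> k \<in> {1..D} \<and> l \<in> {1..D} \<and> 0 < ?w l
      \<and> ?w k * (?R ^ j) ^ k = ?w l * (?R ^ j) ^ l
      \<and> (\<forall>i\<in>{1..D}. ?w i * (?R ^ j) ^ i \<le> ?w l * (?R ^ j) ^ l)}"
  have "card J1 \<le> N"
  proof (rule card_geometric_range_le[OF R])
    fix i j :: nat assume ij: "i \<le> j"
    obtain l where l: "l \<in> {1..D}" "F i = ?c l * (?R ^ i) ^ l" using Fex by blast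
    have Rj: "?R ^ j = ?R ^ i * ?R ^ (j - i)" using ij by (simp flip: power_add)
    \<comment> \<open>The maximising degree \<open>l\<close> is at least 1, hence growth by at least
      the factor \<open>p\<close> per step.\<close>
    have "?R ^ (j - i) \<le> (?R ^ (j - i)) ^ l"
      using l(1) R by (intro self_le_power) (auto intro: one_le_power)
    then have "F i * ?R ^ (j - i) \<le> F i * (?R ^ (j - i)) ^ l"
      using l(2) R by (intro mult_left_mono) auto
    also have "\<dots> = ?c l * (?R ^ j) ^ l" by (simp add: l(2) Rj power_mult_distrib)
    also have "\<dots> \<le> F j" using l(1) by (rule Fge)
    finally show "F i * ?R ^ (j - i) \<le> F j" .
  qed (auto simp: J1_def)
  moreover have "card J2 \<le> D"
    by (rule card_corners_le[OF R, of J2 D ?w]) (auto simp: J2_def)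
  ultimately have card: "card (J1 \<union> J2) \<le> 3 * D + 2"
    using card_Un_le[of J1 J2] by (simp add: N_def)
  have bad: "- 1 \<le> ?I j" for j
    using padic_sphere_char_integral_ge[OF M, of j g] R by (simp add: field_simps)
  have good: "0 \<le> ?I j" if j: "j \<in> {a..T}" "j \<notin> J1 \<union> J2" for j
  proof (cases "F j \<le> 1")
    case True
    have "?c l * (?R ^ j) ^ l \<le> 1" if l: "l \<in> {..D}" for l
    proof (cases "l = 0")
      case True
      \<comment> \<open>The bound on the constant coefficient at radius \<open>p ^ a\<close>
        persists at the larger radius \<open>p ^ j\<close>.\<close>
      have "?c k0 * (?R ^ a) ^ k0 \<le> ?c k0 * (?R ^ j) ^ k0"
        using j(1) R by (intro mult_left_mono power_mono power_increasing) auto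
      also have "\<dots> \<le> 1" using Fge[OF k0(1), of j] \<open>F j \<le> 1\<close> by linarith
      finally show ?thesis using True k0(2) by simp
    next
      case False
      then have "l \<in> {1..D}" using l by auto
      then show ?thesis using Fge[of l j] \<open>F j \<le> 1\<close> by linarith
    qed
    then show ?thesis
      using padic_sphere_integral_nonneg[OF D(1), of j M] R by (intro divide_nonneg_pos) auto
  next
    case False
    then have FN: "?R ^ N \<le> F j" using j by (auto simp: J1_def not_less)
    define W where "W = Max ((\<lambda>l. ?w l * (?R ^ j) ^ l) ` {1..D})"
    have Wge: "?w l * (?R ^ j) ^ l \<le> W" if "l \<in> {1..D}" for l
      unfolding W_def using that by (intro Max_ge) auto
    have "W \<in> (\<lambda>l. ?w l * (?R ^ j) ^ l) ` {1..D}"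
      unfolding W_def using D(2) by (intro Max_in) auto
    then obtain k where k: "k \<in> {1..D}" "W = ?w k * (?R ^ j) ^ k" by blast
    obtain l where l: "l \<in> {1..D}" "F j = ?c l * (?R ^ j) ^ l" using Fex by blast
    have "inverse (?R ^ D) * F j \<le> pnorm (of_nat l :: 'p padic) * F j"
      using l R pnorm_of_nat_ge[of l D, where 'p = 'p] by (intro mult_right_mono) auto
    also have "\<dots> = ?w l * (?R ^ j) ^ l" by (simp add: l(2) pnorm_mult)
    also have "\<dots> \<le> W" using l(1) by (rule Wge)
    finally have WF: "F j \<le> ?R ^ D * W" using R by (simp add: field_simps)
    have "?R ^ D * ?R ^ (D + 2) = ?R ^ N" by (simp add: N_def mult_2 flip: power_add)
    then have "?R ^ D * ?R ^ (D + 2) \<le> ?R ^ D * W" using FN WF by linarith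
    then have "?R ^ (D + 2) \<le> W" using R by simp
    moreover have "?R < ?R ^ (D + 2)"
      using R power_strict_increasing[of 1 "D + 2" ?R] by simp
    ultimately have RW: "?R < W" by linarith
    have "?R ^ 2 * F j \<le> W ^ 2"
    proof -
      have "0 \<le> ?R ^ N" using R by simp
      then have Fj0: "0 \<le> F j" using FN by (rule order_trans)
      have "F j * ?R ^ N \<le> F j * F j"
        using FN Fj0 by (intro mult_left_mono)
      also have "\<dots> \<le> (?R ^ D * W) * (?R ^ D * W)"
        using WF Fj0 order_trans[OF Fj0 WF] by (intro mult_mono)
      finally have "(?R ^ D) ^ 2 * (?R ^ 2 * F j) \<le> (?R ^ D) ^ 2 * W ^ 2"
        by (simp add: N_def power_add power2_eq_square power_mult mult_ac power_mult_distrib)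
      then show ?thesis using R by simp
    qed
    \<comment> \<open>A second degree reaching \<open>W\<close> would be a tie at the maximum and
      would put \<open>j\<close> into \<open>J2\<close>, whichever of the two degrees is
      larger.\<close>
    moreover have "?w i * (?R ^ j) ^ i < W" if i: "i \<in> {1..D}" "i \<noteq> k" for i
    proof (rule ccontr)
      assume "\<not> ?w i * (?R ^ j) ^ i < W"
      then have eq: "?w i * (?R ^ j) ^ i = W" using Wge[OF i(1)] by simp
      have "0 < W" using RW R by linarith
      then have "0 < ?w i * (?R ^ j) ^ i" "0 < ?w k * (?R ^ j) ^ k" using eq k(2) by linarith+
      moreover have "0 < (?R ^ j) ^ l" for l using R by simp
      ultimately have "0 < ?w i" "0 < ?w k" by (metis zero_less_mult_pos2)+
      moreover have "j \<in> J2" if "k' < l'" "k' \<in> {1..D}" "l' \<in> {1..D}" "0 < ?w l'"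
        "?w k' * (?R ^ j) ^ k' = W" "?w l' * (?R ^ j) ^ l' = W" for k' l'
        unfolding J2_def using that j(1) Wge by (intro CollectI conjI exI[of _ k'] exI[of _ l']) simp_all
      ultimately have "j \<in> J2" using i k eq by (metis linorder_neqE_nat)
      then show False using j by simp
    qed
    ultimately have "(LINT s : padic_sphere j | M. Re (padic_char (poly g s))) = 0"
      using RW by (intro padic_sphere_integral_eq_0[OF M D(1) Fge k(1,2)]) auto
    then show ?thesis by simp
  qed
  have "- real (3 * D + 2) \<le> - real (card (J1 \<union> J2))" using card by simp
  also have "\<dots> = (\<Sum>j\<in>J1 \<union> J2. - 1)" by simp
  also have "\<dots> \<le> (\<Sum>j\<in>J1 \<union> J2. ?I j)" by (intro sum_mono bad)
  also have "\<dots> \<le> (\<Sum>j=a..T. ?I j)"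
    by (rule sum_mono2) (use good in \<open>auto simp: J1_def J2_def\<close>)
  finally show ?thesis .
qed

section \<open>The Fourier transform of the measures\<close>

lemma pnorm_coeff_less_of_Ess:
  fixes f :: "'p::prime_card padic poly"
  assumes a: "Ess f < real a" and i: "i < Polynomial.degree f"
  shows "pnorm (Polynomial.coeff f i) * (real CARD('p) ^ a) ^ i
    < pnorm (lead_coeff f) * (real CARD('p) ^ a) ^ Polynomial.degree f"
proof -
  let ?R = "real CARD('p)" and ?c = "\<lambda>i. pnorm (Polynomial.coeff f i)"
  have R: "1 < ?R" by (rule card_gt_1)
  have lc: "0 < pnorm (lead_coeff f)" using i by (intro pnorm_pos) auto
  have less: "?c i < pnorm (lead_coeff f) * ?R ^ a"
  proof (cases "Polynomial.coeff f i = 0")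
    case False
    let ?X = "{log ?R (?c i / pnorm (lead_coeff f)) | i.
      i < Polynomial.degree f \<and> Polynomial.coeff f i \<noteq> 0}"
    have "finite ?X" by simp
    then have "log ?R (?c i / pnorm (lead_coeff f)) \<le> Ess f"
      unfolding Ess_def using i False by (intro Max_ge) auto
    then have "log ?R (?c i / pnorm (lead_coeff f)) < real a" using a by linarith
    then have "?c i / pnorm (lead_coeff f) < ?R powr real a"
      using R lc pnorm_pos[OF False] by (simp add: log_less_iff)
    then show ?thesis using R lc by (simp add: powr_realpow field_simps)
  qed (use lc R in simp)
  \<comment> \<open>The factor \<open>p ^ a\<close> coming from \<open>Ess f < a\<close> is absorbed
    because \<open>i + 1\<close> is at most the degree.\<close>
  have "?c i * (?R ^ a) ^ i < (pnorm (lead_coeff f) * ?R ^ a) * (?R ^ a) ^ i"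
    using less R by (intro mult_strict_right_mono) auto
  also have "\<dots> = pnorm (lead_coeff f) * (?R ^ a) ^ Suc i" by simp
  also have "\<dots> \<le> pnorm (lead_coeff f) * (?R ^ a) ^ Polynomial.degree f"
    using i R lc by (intro mult_left_mono power_increasing) auto
  finally show ?thesis .
qed

text \<open>No cancellation: at the radius \<open>p ^ a\<close> the largest of the leading terms of the
  \<open>\<lambda>\<^sub>i f\<^sub>i\<close> survives in the combination.\<close>

lemma constant_coeff_dominated:
  fixes f :: "nat \<Rightarrow> 'p::prime_card padic poly" and lam :: "nat \<Rightarrow> 'p padic"
  assumes I: "finite I" "I \<noteq> {}"
    and deg: "\<And>i. i \<in> I \<Longrightarrow> 1 \<le> Polynomial.degree (f i)"
    and inj: "inj_on (\<lambda>i. Polynomial.degree (f i)) I"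
    and Ess: "\<And>i. i \<in> I \<Longrightarrow> Ess (f i) < real a"
  defines "g \<equiv> \<Sum>i\<in>I. Polynomial.smult (lam i) (f i)"
  shows "\<exists>i\<in>I. pnorm (Polynomial.coeff g 0)
    \<le> pnorm (Polynomial.coeff g (Polynomial.degree (f i)))
      * (real CARD('p) ^ a) ^ Polynomial.degree (f i)"
proof -
  let ?R = "real CARD('p)"
  let ?d = "\<lambda>i. Polynomial.degree (f i)"
  have R: "1 < ?R" by (rule card_gt_1)
  define A where "A i = pnorm (lam i * lead_coeff (f i)) * (?R ^ a) ^ ?d i" for i
  have "Max (A ` I) \<in> A ` I" using I by (intro Max_in) auto
  then obtain i0 where i0: "i0 \<in> I" "A i0 = Max (A ` I)" by force
  have Amax: "A i \<le> A i0" if "i \<in> I" for i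
    using that I unfolding i0(2) by (intro Max_ge) auto
  have A0: "0 \<le> A i" for i using R by (simp add: A_def)
  have coeff: "Polynomial.coeff g k = (\<Sum>i\<in>I. lam i * Polynomial.coeff (f i) k)" for k
    by (simp add: g_def coeff_sum)
  have small: "pnorm (lam i * Polynomial.coeff (f i) k) * (?R ^ a) ^ k < A i"
    if "i \<in> I" "k < ?d i" "lam i \<noteq> 0" for i k
    using mult_strict_left_mono[OF pnorm_coeff_less_of_Ess[OF Ess[OF that(1)] that(2)]
        pnorm_pos[OF that(3)]]
    by (simp add: A_def pnorm_mult)
  have "pnorm (Polynomial.coeff g 0) \<le> A i0"
    unfolding coeff
  proof (rule pnorm_sum_le)
    fix i assume i: "i \<in> I"
    show "pnorm (lam i * Polynomial.coeff (f i) 0) \<le> A i0"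
    proof (cases "lam i = 0")
      case False
      then show ?thesis using small[of i 0] deg[OF i] Amax[OF i] i by simp
    qed (use A0 in simp)
  qed (rule A0)
  \<comment> \<open>If \<open>A i0 = 0\<close> the bound is trivial; otherwise the leading term of
    index \<open>i0\<close> is shown to dominate the coefficient of \<open>g\<close> in degree
    \<open>?d i0\<close>.\<close>
  also have "A i0 \<le> pnorm (Polynomial.coeff g (?d i0)) * (?R ^ a) ^ ?d i0"
  proof (cases "A i0 = 0")
    case False
    then have pos: "0 < A i0" using A0[of i0] by simp
    then have pos': "0 < pnorm (lam i0 * lead_coeff (f i0))"
      unfolding A_def using R by (simp add: zero_less_mult_iff)
    have "pnorm (Polynomial.coeff g (?d i0)) = pnorm (lam i0 * lead_coeff (f i0))"
      unfolding coeff
    proof (rule pnorm_sum_dominant)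
      fix i assume i: "i \<in> I" "i \<noteq> i0"
      \<comment> \<open>Polynomials of lower degree do not reach degree \<open>?d i0\<close>. Those
        of higher degree contribute a non-leading term there, strictly below their own leading term
        and so below \<open>A i0\<close>.\<close>
      then have "?d i \<noteq> ?d i0" using inj i0(1) by (meson inj_onD)
      then consider "lam i * Polynomial.coeff (f i) (?d i0) = 0" | "?d i0 < ?d i" "lam i \<noteq> 0"
        by (metis coeff_eq_0 linorder_neqE_nat mult_eq_0_iff)
      then show "pnorm (lam i * Polynomial.coeff (f i) (?d i0))
          < pnorm (lam i0 * lead_coeff (f i0))"
      proof cases
        case 1
        show ?thesis unfolding 1 pnorm_0 by (rule pos')
      next
        case 2
        from small[OF i(1) this] Amax[OF i(1)]
        have "pnorm (lam i * Polynomial.coeff (f i) (?d i0)) * (?R ^ a) ^ ?d i0 < A i0"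
          by linarith
        then show ?thesis unfolding A_def using R by simp
      qed
    qed (use I(1) i0(1) pos' in auto)
    then show ?thesis by (simp add: A_def)
  qed (use R in simp)
  finally show ?thesis using i0(1) by blast
qed

text \<open>The character plus its conjugate is twice its real part, and the weight
  \<open>1 / pnorm s\<close> is constant on each sphere.\<close>

lemma muT_hat_eq_sum_spheres:
  fixes f :: "nat \<Rightarrow> 'p::prime_card padic poly" and lam :: "nat \<Rightarrow> 'p padic"
    and m :: nat
  assumes M: "padic_haar M"
  defines "g \<equiv> \<Sum>i=1..m. Polynomial.smult (lam i) (f i)"
  shows "muT_hat M L a T m f lam = of_real (2 / L * (\<Sum>j=a..T.
    (LINT s : padic_sphere j | M. Re (padic_char (poly g s))) / real CARD('p) ^ j))"
proof -
  let ?\<psi> = "\<lambda>s. padic_char (poly g s)"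
  have R: "1 < real CARD('p)" by (rule card_gt_1)
  have g: "(\<Sum>i=1..m. lam i * poly (f i) s) = poly g s" for s
    by (simp add: g_def poly_sum)
  have conv: "(?\<psi> s + cnj (?\<psi> s)) / of_real (pnorm s)
      = complex_of_real (2 * Re (?\<psi> s) / pnorm s)" for s
    by (simp add: complex_add_cnj)
  let ?h = "\<lambda>s. 2 * Re (?\<psi> s) / pnorm s"
  have pn: "(pnorm :: 'p padic \<Rightarrow> real) \<in> borel_measurable borel"
    unfolding pnorm_eq_dist[abs_def]
    by (intro borel_measurable_continuous_onI continuous_intros)
  have meas: "?h \<in> borel_measurable borel"
    using padic_char_poly_borel[of g] pn by measurable
  have int: "set_integrable M (padic_sphere j) ?h" for j
  proof (rule padic_haar_set_integrable_bounded[OF M meas])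
    fix s :: "'p padic" assume s: "s \<in> padic_sphere j"
    have "\<bar>Re (?\<psi> s)\<bar> \<le> 1" using abs_Re_le_cmod[of "?\<psi> s"] by simp
    moreover have "0 < pnorm s" using padic_sphere_neq_0[OF s] by (rule pnorm_pos)
    ultimately show "\<bar>?h s\<bar> \<le> 2 / real CARD('p) ^ j"
      using s by (simp add: padic_sphere_def abs_mult divide_right_mono)
  qed
  have "(LINT s : (\<Union>j\<in>{a..T}. padic_sphere j) | M. ?h s)
      = (\<Sum>j=a..T. LINT s : padic_sphere j | M. ?h s)"
    using M by (intro set_integral_finite_Union int) (auto simp: disjoint_family_padic_sphere)
  also have "\<dots> = (\<Sum>j=a..T. 2 * ((LINT s : padic_sphere j | M. Re (?\<psi> s)) / real CARD('p) ^ j))"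
  proof (rule sum.cong[OF refl])
    fix j
    have "(LINT s : padic_sphere j | M. ?h s)
        = (LINT s : padic_sphere j | M. 2 / real CARD('p) ^ j * Re (?\<psi> s))"
    proof (rule set_lebesgue_integral_cong)
      show "padic_sphere j \<in> sets M" using M by simp
    qed (simp add: padic_sphere_def)
    also have "\<dots> = 2 / real CARD('p) ^ j * (LINT s : padic_sphere j | M. Re (?\<psi> s))"
      by (rule set_integral_mult_right)
    finally show "(LINT s : padic_sphere j | M. ?h s)
        = 2 * ((LINT s : padic_sphere j | M. Re (?\<psi> s)) / real CARD('p) ^ j)" by simp
  qed
  finally have sum: "(LINT s : (\<Union>j\<in>{a..T}. padic_sphere j) | M. ?h s)
      = 2 * (\<Sum>j=a..T. (LINT s : padic_sphere j | M. Re (?\<psi> s)) / real CARD('p) ^ j)"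
    by (simp add: sum_distrib_left)
  show ?thesis
    unfolding muT_hat_def g conv set_integral_complex_of_real annulus_eq_UN_padic_sphere sum
    by simp
qed

theorem theorem4p4:
  fixes f :: "nat \<Rightarrow> 'p::prime_card padic poly"
    and ds :: "'p padic measure"
    and p m a T :: nat
    and a0 L :: real
    and lam :: "nat \<Rightarrow> 'p padic"
  assumes "p = CARD('p)"
    and "padic_haar ds"
    and "m \<ge> 2"
    and "\<And>i j. 1 \<le> i \<Longrightarrow> i < j \<Longrightarrow> j \<le> m \<Longrightarrow> Polynomial.degree (f j) < Polynomial.degree (f i)"
    and "Polynomial.degree (f m) \<ge> 1"
    and "a0 = Max {Ess (f i) | i. 1 \<le> i \<and> i \<le> m}"
    and "0 < a" and "a < T" and "a0 < real a"
    and "L = 2 * (real T - real a + 1) * (1 - 1 / real p)"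
  shows "muT_hat ds L a T m f lam \<in> \<real> \<and>
         - (16 * (\<Sum>i=1..m. real p ^ Polynomial.degree (f i))) / L \<le> Re (muT_hat ds L a T m f lam)"
proof -
  let ?d = "\<lambda>i. Polynomial.degree (f i)"
  define g where "g = (\<Sum>i=1..m. Polynomial.smult (lam i) (f i))"
  define D where "D = ?d 1"
  define I where "I = (\<Sum>j=a..T. (LINT s : padic_sphere j | ds. Re (padic_char (poly g s)))
    / real CARD('p) ^ j)"
  have R: "1 < real p" unfolding assms(1) by (rule card_gt_1)
  have L: "0 < L" unfolding assms(10) using R assms(8) by simp
  have le1: "?d i \<le> D" if "i \<in> {1..m}" for i
    using assms(4)[of 1 i] that by (cases "i = 1") (auto simp: D_def)
  have ge1: "1 \<le> ?d i" if "i \<in> {1..m}" for i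
    using assms(4)[of i m] assms(5) that by (cases "i = m") auto
  have inj: "inj_on ?d {1..m}"
    by (rule inj_onI) (metis assms(4) atLeastAtMost_iff less_irrefl linorder_neqE_nat)
  have Ess: "Ess (f i) < real a" if "i \<in> {1..m}" for i
  proof -
    have "Ess (f i) \<le> a0" unfolding assms(6) using that by (intro Max_ge) auto
    then show ?thesis using assms(9) by linarith
  qed
  obtain i where i: "i \<in> {1..m}" "pnorm (Polynomial.coeff g 0)
      \<le> pnorm (Polynomial.coeff g (?d i)) * (real CARD('p) ^ a) ^ ?d i"
    using constant_coeff_dominated[OF _ _ ge1 inj Ess, of lam] assms(3) by (auto simp: g_def)
  have deg: "Polynomial.degree g \<le> D"
    unfolding g_def using le1
    by (intro degree_sum_le) (auto intro: order_trans[OF degree_smult_le])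
  have D1: "1 \<le> D" using ge1[of 1] assms(3) by (simp add: D_def)
  have I: "- real (3 * D + 2) \<le> I"
    unfolding I_def using le1[OF i(1)] ge1[OF i(1)] i(2)
    by (intro padic_sphere_integral_sum_ge[OF assms(2) deg D1, of "?d i"]) auto
  \<comment> \<open>Since \<open>D >= 1\<close>, \<open>2 * (3 * D + 2) <= 10 * D\<close>, and
    \<open>D\<close> is below \<open>p ^ D\<close>, a single summand of the sum over all degrees.
    This is well within the factor 16.\<close>
  have "D < 2 ^ D" by (rule less_exp)
  then have "real D < 2 ^ D" using of_nat_less_iff[of D "2 ^ D", where 'a = real] by simp
  also have "2 ^ D \<le> real p ^ D" using R by (intro power_mono) auto
  also have "\<dots> \<le> (\<Sum>i=1..m. real p ^ ?d i)"
    unfolding D_def using assms(3) R by (intro member_le_sum) auto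
  finally have "real D \<le> (\<Sum>i=1..m. real p ^ ?d i)" by simp
  then have "- (16 * (\<Sum>i=1..m. real p ^ ?d i)) \<le> 2 * I"
    using I D1 by simp
  then have "- (16 * (\<Sum>i=1..m. real p ^ ?d i)) / L \<le> 2 * I / L"
    using L by (intro divide_right_mono) auto
  moreover have "muT_hat ds L a T m f lam = of_real (2 / L * I)"
    unfolding I_def g_def by (rule muT_hat_eq_sum_spheres[OF assms(2)])
  ultimately show ?thesis by simp
qed

end
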